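(* Let $\{f_j\}_1^n$ be a frame for a subspace $\mathcal{K}\subseteq\mathbb{C}^m$, and suppose that this frame has synthesis matrix $F$ of rank $r$. Let $q=\min\{m,n\}$ and $k\in\{1,\dots,q\}$. Then the symmetric approximations of $\{f_j\}_1^n$ in $\mathcal{J}_{n-k}$ are exactly the families $\{u_j\}_1^n$ given by $$u_j=V\begin{bmatrix} I_k&0\\0&0_{m-k,n-k}\end{bmatrix}W^*e_j,\qquad j=1,\dots,n,$$ where $V$ and $W$ are any pair of unitary matrices such that $F=V\Sigma W^*$ is a singular value decomposition. In particular: when $k<r$, there is a unique symmetric approximation if and only if $s_k(F)\ne s_{k+1}(F)$; when $k=r$, the canonical Parseval frame associated to $\{f_j\}_1^n$ is the unique symmetric approximation; and when $r<k\le q$, there are infinitely many symmetric approximations.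
   Context: A finite family $\{f_j\}_1^n$ of vectors in $\mathbb{C}^m$ is a frame for a subspace $\mathcal{K}$ if it spans $\mathcal{K}$; it is a Parseval frame for $\mathcal{K}$ if moreover $\|f\|^2=\sum_{j=1}^n|\langle f,f_j\rangle|^2$ for all $f\in\mathcal{K}$. The synthesis matrix of $\{f_j\}_1^n$ is the $m\times n$ matrix with columns $f_1,\dots,f_n$. The excess of a frame $\{f_j\}_1^n$ for $\mathcal{K}$ is $n-\dim\mathcal{K}$ (the greatest number of vectors that can be removed with the remaining ones still spanning $\mathcal{K}$). $\mathcal{J}_{n-k}$ is the set of all families $\{w_j\}_1^n$ of $n$ vectors in $\mathbb{C}^m$ that are Parseval frames for some subspace of $\mathbb{C}^m$ (not fixed) and have excess $n-k$. For a family $\mathcal{J}$ of Parseval frames with $n$ vectors, $\{u_j\}_1^n\in\mathcal{J}$ is a symmetric approximation of $\{f_j\}_1^n$ in $\mathcal{J}$ if $\sum_{j=1}^n\|f_j-u_j\|^2\le\sum_{j=1}^n\|f_j-x_j\|^2$ for all $\{x_j\}_1^n\in\mathcal{J}$. $\{e_j\}_1^n$ is the standard basis of $\mathbb{C}^n$. $s_1(F)\ge\dots\ge s_q(F)\ge0$ are the singular values of $F$. A singular value decomposition is $F=V\Sigma W^*$ with $V$ ($m\times m$) and $W$ ($n\times n$) unitary and $\Sigma=\begin{bmatrix}\Sigma_r&0\\0&0_{m-r,n-r}\end{bmatrix}$, $\Sigma_r=\mathrm{diag}(s_1(F),\dots,s_r(F))$. The canonical Parseval frame associated to $\{f_j\}_1^n$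 is $\{Ue_j\}_1^n$, where $F=U|F|$, $|F|=(F^*F)^{1/2}$, is the canonical polar decomposition, i.e. $U$ is the unique partial isometry with $F=U|F|$ and $\ker(U)=\ker(F)$ (a partial isometry is a matrix $X$ with $\|Xf\|=\|f\|$ for all $f\in\ker(X)^\perp$). *)

theory Defs
  imports
    "Jordan_Normal_Form.Schur_Decomposition"
    "Jordan_Normal_Form.Matrix_Kernel"
    "Jordan_Normal_Form.DL_Rank"
    "HOL-Computational_Algebra.Polynomial"
    "HOL-Library.Multiset"
begin

text \<open>
  A family of \<open>n\<close> vectors of \<open>\<complex>\<^sup>m\<close> is a list of length \<open>n\<close> over \<^term>\<open>carrier_vec m\<close>; positions
  count from \<open>0\<close>, so \<open>f ! j\<close> is the vector usually written \<open>f\<^sub>j\<^sub>+\<^sub>1\<close>. The inner product is the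
  library's \<open>x \<bullet>c y\<close>, which is conjugate-linear in \<open>y\<close>.
\<close>

abbreviation cspace :: "nat \<Rightarrow> (complex, complex vec) module" where
  "cspace m \<equiv> module_vec TYPE(complex) m"

definition vnorm :: "complex vec \<Rightarrow> real" where
  "vnorm v = sqrt (Re (v \<bullet>c v))"

section \<open>Frames\<close>

definition frame_for :: "nat \<Rightarrow> complex vec list \<Rightarrow> complex vec set \<Rightarrow> bool" where
  "frame_for m f K \<longleftrightarrow>
     VectorSpace.subspace class_ring K (cspace m) \<and>
     set f \<subseteq> carrier_vec m \<and>
     LinearCombinations.module.span class_ring (cspace m) (set f) = K"

definition parseval_frame_for :: "nat \<Rightarrow> complex vec list \<Rightarrow> complex vec set \<Rightarrow> bool" where
  "parseval_frame_for m f K \<longleftrightarrow>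
     frame_for m f K \<and>
     (\<forall>x\<in>K. (vnorm x)\<^sup>2 = (\<Sum>j<length f. (cmod (x \<bullet>c (f ! j)))\<^sup>2))"

text \<open>The subtraction does not truncate when \<open>f\<close> is a frame for \<open>K\<close>.\<close>

definition excess :: "nat \<Rightarrow> complex vec list \<Rightarrow> complex vec set \<Rightarrow> nat" where
  "excess m f K = length f - vectorspace.dim class_ring ((cspace m)\<lparr>carrier := K\<rparr>)"

definition parseval_frames :: "nat \<Rightarrow> nat \<Rightarrow> nat \<Rightarrow> complex vec list set" where
  "parseval_frames m n d =
     {w. length w = n \<and> (\<exists>K. parseval_frame_for m w K \<and> excess m w K = d)}"

definition symmetric_approximation ::
  "complex vec list set \<Rightarrow> complex vec list \<Rightarrow> complex vec list \<Rightarrow> bool" where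
  "symmetric_approximation J f u \<longleftrightarrow>
     u \<in> J \<and>
     (\<forall>x\<in>J. (\<Sum>j<length f. (vnorm (f ! j - u ! j))\<^sup>2)
           \<le> (\<Sum>j<length f. (vnorm (f ! j - x ! j))\<^sup>2))"

text \<open>The family \<open>(A e\<^sub>j)\<^sub>j\<close> of images of the standard basis.\<close>

definition column_family :: "complex mat \<Rightarrow> complex vec list" where
  "column_family A = map (\<lambda>j. A *\<^sub>v unit_vec (dim_col A) j) [0..<dim_col A]"

section \<open>Singular values and singular value decompositions\<close>

text \<open>
  The eigenvalues of \<open>F\<^sup>*F\<close> with algebraic multiplicity are real and nonnegative; their square
  roots are listed in decreasing order. There are \<^term>\<open>dim_col F\<close> of them, and those beyond
  position \<open>min (dim_row F) (dim_col F)\<close> vanish and are dropped.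
\<close>

definition singular_values :: "complex mat \<Rightarrow> real list" where
  "singular_values F =
     take (min (dim_row F) (dim_col F))
       (rev (sorted_list_of_multiset
         (image_mset (\<lambda>z. sqrt (Re z)) (proots (char_poly (mat_adjoint F * F))))))"

text \<open>The index counts from \<open>1\<close>.\<close>

definition singular_value :: "complex mat \<Rightarrow> nat \<Rightarrow> real" where
  "singular_value F i = singular_values F ! (i - 1)"

definition unitary_mat :: "nat \<Rightarrow> complex mat \<Rightarrow> bool" where
  "unitary_mat n U \<longleftrightarrow>
     U \<in> carrier_mat n n \<and> mat_adjoint U * U = 1\<^sub>m n \<and> U * mat_adjoint U = 1\<^sub>m n"

text \<open>The \<open>m \<times> n\<close> matrix with the \<open>k \<times> k\<close> block \<open>A\<close> in the upper left corner and zeros elsewhere.\<close>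

definition block_corner :: "nat \<Rightarrow> nat \<Rightarrow> nat \<Rightarrow> complex mat \<Rightarrow> complex mat" where
  "block_corner m n k A =
     four_block_mat A (0\<^sub>m k (n - k)) (0\<^sub>m (m - k) k) (0\<^sub>m (m - k) (n - k))"

definition is_svd :: "nat \<Rightarrow> nat \<Rightarrow> complex mat \<Rightarrow> complex mat \<Rightarrow> complex mat \<Rightarrow> bool" where
  "is_svd m n F V W \<longleftrightarrow>
     unitary_mat m V \<and> unitary_mat n W \<and>
     (let r = vec_space.rank m F;
          S = mat_diag r (\<lambda>i. complex_of_real (singular_value F (i + 1)))
      in F = V * block_corner m n r S * mat_adjoint W)"

section \<open>Canonical polar decomposition\<close>

definition psd_mat :: "nat \<Rightarrow> complex mat \<Rightarrow> bool" where
  "psd_mat n P \<longleftrightarrow>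
     P \<in> carrier_mat n n \<and> mat_adjoint P = P \<and>
     (\<forall>v\<in>carrier_vec n. 0 \<le> Re ((P *\<^sub>v v) \<bullet>c v))"

text \<open>\<open>|F| = (F\<^sup>*F)\<^sup>1\<^sup>/\<^sup>2\<close> is the unique positive semidefinite square root of \<open>F\<^sup>*F\<close>.\<close>

definition mat_abs :: "complex mat \<Rightarrow> complex mat" where
  "mat_abs F = (THE P. psd_mat (dim_col F) P \<and> P * P = mat_adjoint F * F)"

text \<open>
  The inner quantifier says \<open>x \<in> ker(X)\<^sup>\<bottom>\<close>; the library's \<open>orthogonal_complement\<close> is taken with
  respect to the bilinear product and cannot be used over \<open>\<complex>\<close>.
\<close>

definition partial_isometry :: "complex mat \<Rightarrow> bool" where
  "partial_isometry X \<longleftrightarrow>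
     (\<forall>x\<in>carrier_vec (dim_col X).
        (\<forall>y\<in>mat_kernel X. x \<bullet>c y = 0) \<longrightarrow> vnorm (X *\<^sub>v x) = vnorm x)"

definition polar_factor :: "complex mat \<Rightarrow> complex mat" where
  "polar_factor F =
     (THE U. U \<in> carrier_mat (dim_row F) (dim_col F) \<and> partial_isometry U \<and>
             F = U * mat_abs F \<and> mat_kernel U = mat_kernel F)"

definition canonical_parseval_frame :: "nat \<Rightarrow> complex vec list \<Rightarrow> complex vec list" where
  "canonical_parseval_frame m f = column_family (polar_factor (mat_of_cols m f))"

end

theory Submission
  imports Defs
begin

text \<open>
  Write \<open>E\<^sub>k\<close> for the \<open>m \<times> n\<close> matrix with the identity of size \<open>k\<close> in its upper left corner and
  fix one singular value decomposition \<open>F = V\<Sigma>W\<^sup>*\<close>. A family of \<open>n\<close> vectors is a Parseval frame of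
  excess \<open>n - k\<close> exactly when its synthesis matrix is a partial isometry of rank \<open>k\<close>, that is,
  \<open>X = V(AE\<^sub>kB\<^sup>*)W\<^sup>*\<close> with \<open>A\<close> and \<open>B\<close> unitary (\<open>parseval_frames_eq\<close>). All these \<open>X\<close> have the same
  Frobenius norm, so minimising the distance to \<open>F\<close> means maximising
  \<open>\<Sum>\<^sub>i s\<^sub>i Re (AE\<^sub>kB\<^sup>*)\<^sub>i\<^sub>i = \<Sum>\<^sub>i s\<^sub>i \<Sum>\<^sub>l\<^sub>\<le>\<^sub>k Re (A\<^sub>i\<^sub>l cnj B\<^sub>i\<^sub>l)\<close>, called the gain below.

  Since \<open>2 Re (z cnj w) = |z|\<^sup>2 + |w|\<^sup>2 - |z - w|\<^sup>2\<close>, the gain is at most the mean of the two sums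
  \<open>\<Sum>\<^sub>i s\<^sub>i a\<^sub>i\<close>, where \<open>a\<^sub>i\<close> is the squared norm of the \<open>i\<close>-th row of the first \<open>k\<close> columns of \<open>A\<close>,
  respectively of \<open>B\<close>. These weights lie between \<open>0\<close> and \<open>1\<close> and add up to \<open>k\<close>, so each sum is at
  most \<open>s\<^sub>1 + \<dots> + s\<^sub>k\<close>, and \<open>A = B = 1\<close> attains this bound (\<open>weighted_sum_bound\<close>, \<open>gain_bound\<close>).

  Equality says two things. The first \<open>k\<close> columns of \<open>A\<close> and \<open>B\<close> agree in every row with
  \<open>s\<^sub>i > 0\<close>, and the weights are \<open>1\<close> where \<open>s\<^sub>i > s\<^sub>k\<close> and \<open>0\<close> where \<open>s\<^sub>i < s\<^sub>k\<close>. Together they make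
  \<open>A\<^sup>*\<Sigma>B\<close> block diagonal with a Hermitian block of size \<open>k\<close>. Diagonalising the two blocks leaves
  \<open>E\<^sub>k\<close> in place and turns \<open>VA\<close>, \<open>WB\<close> into another singular value decomposition of \<open>F\<close>, which
  exhibits \<open>X\<close> in the required form (\<open>maximiser_is_svd_corner\<close>).

  If \<open>s\<^sub>k > s\<^sub>k\<^sub>+\<^sub>1\<close>, equality even forces \<open>AE\<^sub>kB\<^sup>* = E\<^sub>k\<close> (\<open>maximiser_unique\<close>). This covers \<open>k = r\<close>,
  where \<open>VE\<^sub>rW\<^sup>*\<close> is the partial isometry of the polar decomposition (\<open>polar_factor_svd\<close>). If
  \<open>s\<^sub>k = s\<^sub>k\<^sub>+\<^sub>1 > 0\<close>, exchanging the corresponding singular vectors gives a second minimiser; if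
  \<open>s\<^sub>k = 0\<close>, multiplying the \<open>k\<close>-th left singular vector by phases gives infinitely many.

  Matrix positions and sequences count from \<open>0\<close> in the formal text: \<open>s\<^sub>k\<close> is \<^term>\<open>s (k - 1)\<close>.
\<close>

section \<open>Adjoints and unitary matrices\<close>

lemma adjoint_dim [simp]:
  "dim_row (mat_adjoint A) = dim_col A" "dim_col (mat_adjoint A) = dim_row A"
  by (auto simp: mat_adjoint_def)

lemma adjoint_index [simp]:
  "i < dim_col A \<Longrightarrow> j < dim_row A \<Longrightarrow> mat_adjoint A $$ (i, j) = cnj (A $$ (j, i))"
  by (simp add: mat_adjoint_def mat_of_rows_index)

lemma adjoint_carrier [simp]: "A \<in> carrier_mat m n \<Longrightarrow> mat_adjoint A \<in> carrier_mat n m"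
  by (intro carrier_matI) simp_all

lemma adjoint_adjoint [simp]: "mat_adjoint (mat_adjoint (A :: complex mat)) = A"
  by (rule eq_matI) auto

lemma adjoint_one [simp]: "mat_adjoint (1\<^sub>m n) = (1\<^sub>m n :: complex mat)"
  by (rule eq_matI) auto

text \<open>
  Entries of products as sums over an initial segment, and associativity with dimensions in place
  of carriers: in this form the simplifier can discharge the side conditions.
\<close>

lemma mult_index:
  "i < dim_row A \<Longrightarrow> j < dim_col B \<Longrightarrow> dim_col A = dim_row B \<Longrightarrow>
    (A * B) $$ (i, j) = (\<Sum>l<dim_row B. A $$ (i, l) * B $$ (l, j))"
  by (simp add: scalar_prod_def atLeast0LessThan)

lemma mult_vec_index:
  "i < dim_row A \<Longrightarrow> dim_col A = dim_vec v \<Longrightarrow>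
    (A *\<^sub>v v) $ i = (\<Sum>l<dim_vec v. A $$ (i, l) * v $ l)"
  by (simp add: scalar_prod_def atLeast0LessThan)

lemma adjoint_mult:
  assumes AB: "dim_col A = dim_row (B :: complex mat)"
  shows "mat_adjoint (A * B) = mat_adjoint B * mat_adjoint A"
proof (rule eq_matI)
  fix i j assume "i < dim_row (mat_adjoint B * mat_adjoint A)"
    and "j < dim_col (mat_adjoint B * mat_adjoint A)"
  hence ij: "i < dim_col B" "j < dim_row A" by auto
  have "mat_adjoint (A * B) $$ (i, j) = cnj ((A * B) $$ (j, i))"
    using ij by (subst adjoint_index) auto
  also have "\<dots> = (\<Sum>l<dim_row B. cnj (A $$ (j, l)) * cnj (B $$ (l, i)))"
    using ij AB by (subst mult_index) auto
  also have "\<dots> = (mat_adjoint B * mat_adjoint A) $$ (i, j)"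
    using ij AB by (subst mult_index) (auto simp: mult.commute intro!: sum.cong)
  finally show "mat_adjoint (A * B) $$ (i, j) = (mat_adjoint B * mat_adjoint A) $$ (i, j)" .
qed auto

lemma mult_assoc_dim:
  fixes A B C :: "complex mat"
  assumes "dim_col A = dim_row B" "dim_col B = dim_row C"
  shows "A * B * C = A * (B * C)"
  using assms by (intro assoc_mult_mat[of A "dim_row A" "dim_col A" B "dim_col B" C "dim_col C"]) auto

lemma adjoint_four_block:
  fixes A B C D :: "complex mat"
  assumes "A \<in> carrier_mat a c" "B \<in> carrier_mat a d" "C \<in> carrier_mat b c" "D \<in> carrier_mat b d"
  shows "mat_adjoint (four_block_mat A B C D) =
    four_block_mat (mat_adjoint A) (mat_adjoint C) (mat_adjoint B) (mat_adjoint D)"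
  by (rule eq_matI) (use assms in \<open>auto simp: not_less\<close>)

lemma unitary_carrier: "unitary_mat n U \<Longrightarrow> U \<in> carrier_mat n n"
  and unitary_left: "unitary_mat n U \<Longrightarrow> mat_adjoint U * U = 1\<^sub>m n"
  and unitary_right: "unitary_mat n U \<Longrightarrow> U * mat_adjoint U = 1\<^sub>m n"
  and unitary_dim: "unitary_mat n U \<Longrightarrow> dim_row U = n" "unitary_mat n U \<Longrightarrow> dim_col U = n"
  by (auto simp: unitary_mat_def)

lemma unitary_cancel:
  assumes "unitary_mat n U" "dim_row B = n"
  shows "mat_adjoint U * (U * B) = B" "U * (mat_adjoint U * B) = B"
  using assms by (simp_all add: mult_assoc_dim[symmetric] unitary_dim unitary_left unitary_right)

lemma unitary_adjoint: "unitary_mat n U \<Longrightarrow> unitary_mat n (mat_adjoint U)"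
  by (auto simp: unitary_mat_def)

lemma unitary_one [simp]: "unitary_mat n (1\<^sub>m n)"
  by (simp add: unitary_mat_def)

lemma unitaryI:
  assumes U: "U \<in> carrier_mat n n" and UU: "mat_adjoint U * U = 1\<^sub>m n"
  shows "unitary_mat n U"
  using mat_mult_left_right_inverse[OF adjoint_carrier[OF U] U UU] assms
  by (simp add: unitary_mat_def)

lemma unitary_mult:
  assumes "unitary_mat n U" "unitary_mat n V"
  shows "unitary_mat n (U * V)"
  using assms unitary_carrier[OF assms(1)] unitary_carrier[OF assms(2)]
  by (intro unitaryI)
     (auto simp: adjoint_mult unitary_dim mult_assoc_dim unitary_cancel unitary_left)

abbreviation block_diag :: "complex mat \<Rightarrow> complex mat \<Rightarrow> complex mat" where
  "block_diag A D \<equiv>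
     four_block_mat A (0\<^sub>m (dim_row A) (dim_col D)) (0\<^sub>m (dim_row D) (dim_col A)) D"

lemma adjoint_zero [simp]: "mat_adjoint (0\<^sub>m a b) = (0\<^sub>m b a :: complex mat)"
  by (rule eq_matI) auto

lemma adjoint_block_diag: "mat_adjoint (block_diag A D) = block_diag (mat_adjoint A) (mat_adjoint D)"
  by (subst adjoint_four_block[of _ "dim_row A" "dim_col A" _ "dim_col D" _ "dim_row D"]) auto

lemma block_diag_mult:
  assumes "A \<in> carrier_mat a b" "A' \<in> carrier_mat b c" "D \<in> carrier_mat p q" "D' \<in> carrier_mat q r"
  shows "block_diag A D * block_diag A' D' = block_diag (A * A') (D * D')"
proof -
  have "A * A' \<in> carrier_mat a c" "D * D' \<in> carrier_mat p r" using assms by auto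
  thus ?thesis
    using assms
    by (subst mult_four_block_mat[of _ a b _ q _ p _ _ c _ r]) auto
qed

lemma unitary_block_diag:
  assumes "unitary_mat a U" "unitary_mat b V"
  shows "unitary_mat (a + b) (block_diag U V)"
proof (rule unitaryI)
  have c: "U \<in> carrier_mat a a" "V \<in> carrier_mat b b"
    using assms by (auto simp: unitary_mat_def)
  thus "block_diag U V \<in> carrier_mat (a + b) (a + b)" by auto
  show "mat_adjoint (block_diag U V) * block_diag U V = 1\<^sub>m (a + b)"
    unfolding adjoint_block_diag
    by (subst block_diag_mult[of _ a a _ a _ b b _ b])
       (use c assms in \<open>auto simp: unitary_left\<close>)
qed

lemma two_sided_mult:
  fixes A B C D X :: "complex mat"
  assumes "A \<in> carrier_mat m m" "C \<in> carrier_mat m m" "X \<in> carrier_mat m n"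
    "D \<in> carrier_mat n n" "B \<in> carrier_mat n n"
  shows "A * C * X * mat_adjoint (B * D) = A * (C * X * mat_adjoint D) * mat_adjoint B"
  using assms by (simp add: adjoint_mult mult_assoc_dim)

lemma unitary_columns:
  assumes U: "unitary_mat n U" and ij: "i < n" "j < n"
  shows "(\<Sum>l<n. cnj (U $$ (l, i)) * U $$ (l, j)) = (if i = j then 1 else 0)"
proof -
  have "(mat_adjoint U * U) $$ (i, j) = (if i = j then 1 else 0)"
    using assms by (simp add: unitary_left)
  moreover have "(mat_adjoint U * U) $$ (i, j) = (\<Sum>l<n. cnj (U $$ (l, i)) * U $$ (l, j))"
    using unitary_dim[OF U] ij by (subst mult_index) auto
  ultimately show ?thesis by simp
qed

lemma unitary_rows:
  assumes U: "unitary_mat n U" and ij: "i < n" "j < n"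
  shows "(\<Sum>l<n. U $$ (i, l) * cnj (U $$ (j, l))) = (if i = j then 1 else 0)"
  using unitary_columns[OF unitary_adjoint[OF U] ij] unitary_dim[OF U] ij by simp

lemma cnj_mult_self: "cnj z * z = complex_of_real ((cmod z)\<^sup>2)" "z * cnj z = complex_of_real ((cmod z)\<^sup>2)"
  using complex_norm_square[of z] by (simp_all add: mult.commute)

lemma unitary_column_norm:
  assumes "unitary_mat n U" "i < n"
  shows "(\<Sum>l<n. (cmod (U $$ (l, i)))\<^sup>2) = 1"
proof -
  have "complex_of_real (\<Sum>l<n. (cmod (U $$ (l, i)))\<^sup>2) = complex_of_real 1"
    using unitary_columns[OF assms assms(2)] by (simp add: cnj_mult_self)
  thus ?thesis unfolding of_real_eq_iff .
qed

lemma unitary_row_norm: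
  assumes "unitary_mat n U" "i < n"
  shows "(\<Sum>l<n. (cmod (U $$ (i, l)))\<^sup>2) = 1"
  using unitary_column_norm[OF unitary_adjoint[OF assms(1)] assms(2)] unitary_dim[OF assms(1)] assms(2)
  by simp

lemma vnorm_eq: "vnorm v = sqrt (\<Sum>i<dim_vec v. (cmod (v $ i))\<^sup>2)"
  by (simp add: vnorm_def scalar_prod_def atLeast0LessThan cnj_mult_self)

lemma vnorm_sq: "(vnorm v)\<^sup>2 = (\<Sum>i<dim_vec v. (cmod (v $ i))\<^sup>2)"
  by (simp add: vnorm_eq sum_nonneg)

text \<open>Extend \<open>v\<close> to a basis, apply Gram--Schmidt, which keeps \<open>v\<close>, and normalise the columns.\<close>

lemma unitary_completion:
  assumes v: "v \<in> carrier_vec n" and n1: "vnorm v = 1"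
  obtains U where "unitary_mat n U" "\<And>i. i < n \<Longrightarrow> U $$ (i, 0) = v $ i"
proof -
  have s1: "(\<Sum>i<n. (cmod (v $ i))\<^sup>2) = 1"
    using vnorm_sq[of v] v n1 by simp
  have v0: "v \<noteq> 0\<^sub>v n" using s1 by auto
  have n: "n \<noteq> 0" using s1 by (intro notI) simp
  interpret cof_vec_space n "TYPE(complex)" .
  define b where "b = basis_completion v"
  define ws where "ws = gram_schmidt n b"
  define W where "W = mat_of_cols n ws"
  from basis_completion[OF v v0, folded b_def]
  have dist_b: "distinct b" and indep: "\<not> lin_dep (set b)" and b: "set b \<subseteq> carrier_vec n"
    and hdb: "hd b = v" and len_b: "length b = n" by auto
  from hdb len_b n obtain vs where bv: "b = v # vs" by (cases b) auto
  from gram_schmidt_result[OF b dist_b indep refl, folded ws_def]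
  have ws: "set ws \<subseteq> carrier_vec n" "corthogonal ws" "length ws = n"
    by (auto simp: len_b)
  from gram_schmidt_hd[OF v, of vs, folded bv] have hdws: "hd ws = v" unfolding ws_def .
  have W: "W \<in> carrier_mat n n"
    using ws unfolding W_def using mat_of_cols_carrier(1)[of n ws] by auto
  have Wi: "W $$ (i, j) = ws ! j $ i" if "i < n" "j < n" for i j
    using that ws(3) by (simp add: W_def mat_of_cols_index)
  have wsc: "ws ! j \<in> carrier_vec n" if "j < n" for j
    using that ws by auto
  define c where "c j = (\<Sum>l<n. (cmod (W $$ (l, j)))\<^sup>2)" for j
  have ip: "ws ! j \<bullet>c ws ! i = (\<Sum>l<n. cnj (W $$ (l, i)) * W $$ (l, j))" if "i < n" "j < n" for i j
    using that wsc[OF that(1)] wsc[OF that(2)]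
    by (auto simp: scalar_prod_def atLeast0LessThan Wi mult.commute intro!: sum.cong)
  have orth: "(\<Sum>l<n. cnj (W $$ (l, i)) * W $$ (l, j)) = (if i = j then complex_of_real (c i) else 0)"
    if "i < n" "j < n" for i j
    using corthogonalD[OF ws(2), of j i] ip[OF that] that ws(3)
    by (auto simp: c_def cnj_mult_self)
  have c0: "c j \<noteq> 0" if "j < n" for j
    using corthogonalD[OF ws(2), of j j] ip[OF that that] orth[OF that that] that ws(3) by auto
  have cpos: "c j > 0" if "j < n" for j
    using c0[OF that] sum_nonneg[of "{..<n}" "\<lambda>l. (cmod (W $$ (l, j)))\<^sup>2"] by (simp add: c_def less_le)
  define U where "U = mat n n (\<lambda>(i, j). W $$ (i, j) / complex_of_real (sqrt (c j)))"
  have U: "U \<in> carrier_mat n n" by (simp add: U_def)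
  have "mat_adjoint U * U = 1\<^sub>m n"
  proof (rule eq_matI)
    fix i j assume "i < dim_row (1\<^sub>m n :: complex mat)" "j < dim_col (1\<^sub>m n :: complex mat)"
    hence ij: "i < n" "j < n" by auto
    have "(mat_adjoint U * U) $$ (i, j) = (\<Sum>l<n. cnj (U $$ (l, i)) * U $$ (l, j))"
      using U ij by (subst mult_index) auto
    also have "\<dots> = (\<Sum>l<n. cnj (W $$ (l, i)) * W $$ (l, j)) / complex_of_real (sqrt (c i) * sqrt (c j))"
      using ij by (simp add: U_def sum_divide_distrib)
    also have "\<dots> = (if i = j then 1 else 0)"
      using ij cpos[of i] by (subst orth) (auto simp: simp flip: of_real_mult)
    finally show "(mat_adjoint U * U) $$ (i, j) = 1\<^sub>m n $$ (i, j)" using ij by simp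
  qed (use U in auto)
  from unitaryI[OF U this] have "unitary_mat n U" .
  moreover have "U $$ (i, 0) = v $ i" if "i < n" for i
  proof -
    have w0: "ws ! 0 = v" using hdws ws(3) n by (cases ws) auto
    have "c 0 = 1" using s1 n by (simp add: c_def Wi w0)
    thus ?thesis using that n by (simp add: U_def Wi w0)
  qed
  ultimately show ?thesis by (rule that)
qed

section \<open>The spectral theorem and singular value decompositions\<close>

definition rdiag :: "nat \<Rightarrow> nat \<Rightarrow> (nat \<Rightarrow> real) \<Rightarrow> complex mat" where
  "rdiag m n s = mat m n (\<lambda>(i, j). if i = j then complex_of_real (s i) else 0)"

lemma rdiag_carrier [simp]: "rdiag m n s \<in> carrier_mat m n"
  and rdiag_dim [simp]: "dim_row (rdiag m n s) = m" "dim_col (rdiag m n s) = n"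
  and rdiag_index [simp]:
    "i < m \<Longrightarrow> j < n \<Longrightarrow> rdiag m n s $$ (i, j) = (if i = j then complex_of_real (s i) else 0)"
  by (simp_all add: rdiag_def)

lemma adjoint_rdiag [simp]: "mat_adjoint (rdiag m n s) = rdiag n m s"
  by (rule eq_matI) auto

lemma rdiag_mult_index:
  assumes "A \<in> carrier_mat n p" "i < m" "j < p"
  shows "(rdiag m n s * A) $$ (i, j) = (if i < n then complex_of_real (s i) * A $$ (i, j) else 0)"
proof -
  have "(rdiag m n s * A) $$ (i, j) = (\<Sum>l<n. rdiag m n s $$ (i, l) * A $$ (l, j))"
    using assms by (subst mult_index) auto
  also have "\<dots> = (\<Sum>l<n. if l = i then complex_of_real (s i) * A $$ (i, j) else 0)"
    using assms by (intro sum.cong) auto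
  finally show ?thesis by simp
qed

lemma mult_rdiag_index:
  assumes "A \<in> carrier_mat m n" "i < m" "j < p"
  shows "(A * rdiag n p s) $$ (i, j) = (if j < n then A $$ (i, j) * complex_of_real (s j) else 0)"
proof -
  have "(A * rdiag n p s) $$ (i, j) = (\<Sum>l<n. A $$ (i, l) * rdiag n p s $$ (l, j))"
    using assms by (subst mult_index) auto
  also have "\<dots> = (\<Sum>l<n. if l = j then A $$ (i, j) * complex_of_real (s j) else 0)"
    using assms by (intro sum.cong) auto
  finally show ?thesis by simp
qed

lemma rdiag_rdiag:
  "rdiag m n s * rdiag n p t = rdiag m p (\<lambda>i. if i < n then s i * t i else 0)"
  by (rule eq_matI) (auto simp: rdiag_mult_index[of _ n p] simp del: index_mult_mat(1))

lemma rdiag_block: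
  assumes "k \<le> m" "k \<le> n"
  shows "rdiag m n s = block_diag (rdiag k k s) (rdiag (m - k) (n - k) (\<lambda>i. s (i + k)))"
  by (rule eq_matI) (use assms in auto)

lemma gram_index:
  assumes "C \<in> carrier_mat m n" "i < n" "j < n"
  shows "(mat_adjoint C * C) $$ (i, j) = (\<Sum>l<m. cnj (C $$ (l, i)) * C $$ (l, j))"
  using assms by (subst mult_index) auto

lemma gram_diag:
  assumes C: "C \<in> carrier_mat m n" and CC: "mat_adjoint C * C = rdiag n n d" and i: "i < n"
  shows "(\<Sum>l<m. (cmod (C $$ (l, i)))\<^sup>2) = d i"
proof -
  have "complex_of_real (\<Sum>l<m. (cmod (C $$ (l, i)))\<^sup>2) = complex_of_real (d i)"
    using gram_index[OF C i i] i unfolding CC by (simp add: cnj_mult_self)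
  thus ?thesis unfolding of_real_eq_iff .
qed

lemma eigenvalue_unit_eigenvector:
  assumes A: "A \<in> carrier_mat n n" and e: "eigenvalue A e"
  obtains v where "v \<in> carrier_vec n" "vnorm v = 1" "A *\<^sub>v v = e \<cdot>\<^sub>v v"
proof -
  from e obtain w where w: "w \<in> carrier_vec n" "w \<noteq> 0\<^sub>v n" "A *\<^sub>v w = e \<cdot>\<^sub>v w"
    using A by (auto simp: eigenvalue_def eigenvector_def)
  define N where "N = (\<Sum>i<n. (cmod (w $ i))\<^sup>2)"
  have "\<exists>i<n. w $ i \<noteq> 0" using w by (metis carrier_vecD eq_vecI index_zero_vec)
  then obtain i where i: "i < n" "w $ i \<noteq> 0" by auto
  have "N > 0"
    unfolding N_def using i by (intro sum_pos2[of _ i]) auto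
  define v where "v = complex_of_real (1 / sqrt N) \<cdot>\<^sub>v w"
  have v: "v \<in> carrier_vec n" using w by (simp add: v_def)
  have "(\<Sum>i<n. (cmod (v $ i))\<^sup>2) = (\<Sum>i<n. (cmod (w $ i))\<^sup>2 / N)"
    using w(1) \<open>N > 0\<close>
    by (simp add: v_def norm_divide norm_mult power_divide power_mult_distrib)
  also have "\<dots> = 1" using \<open>N > 0\<close> by (simp flip: sum_divide_distrib N_def)
  finally have "vnorm v = 1" using v by (simp add: vnorm_eq)
  moreover have "A *\<^sub>v v = e \<cdot>\<^sub>v v"
    using A w by (simp add: v_def mult_mat_vec smult_smult_assoc mult.commute)
  ultimately show ?thesis using v by (intro that)
qed

text \<open>
  Induction by deflation: in an orthonormal basis that starts with a unit eigenvector, a Hermitian matrix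
  splits off a \<open>1 \<times> 1\<close> block. Prescribing the list of roots fixes the order of the eigenvalues.
\<close>

lemma hermitian_diagonalization:
  assumes "A \<in> carrier_mat n n" "mat_adjoint A = A" "char_poly A = (\<Prod>e\<leftarrow>es. [:- e, 1:])"
  shows "\<exists>U. unitary_mat n U \<and> A = U * mat_diag n (\<lambda>i. es ! i) * mat_adjoint U"
  using assms
proof (induction es arbitrary: n A)
  case Nil
  with degree_monic_char_poly[of A n] have "n = 0" by auto
  with Nil show ?case by (intro exI[of _ "1\<^sub>m n"]) (auto intro!: eq_matI)
next
  case (Cons e es n A)
  note A = Cons.prems(1) and herm = Cons.prems(2)
  have cp: "char_poly A = [:- e, 1:] * (\<Prod>e\<leftarrow>es. [:- e, 1:])" using Cons.prems(3) by simp
  have mon: "monic (\<Prod>e\<leftarrow>es. [:- e, 1:])" by (rule monic_prod_list) auto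
  have deg: "degree (char_poly A) = Suc (degree (\<Prod>e\<leftarrow>es. [:- e, 1:]))"
    unfolding cp by (subst degree_mult_eq) (use mon in auto)
  with degree_monic_char_poly[OF A] have "n \<noteq> 0" by auto
  then obtain n' where n: "n = Suc n'" by (cases n) auto
  have "eigenvalue A e"
    unfolding eigenvalue_root_char_poly[OF A] cp by simp
  from eigenvalue_unit_eigenvector[OF A this] obtain v
    where v: "v \<in> carrier_vec n" "vnorm v = 1" "A *\<^sub>v v = e \<cdot>\<^sub>v v" by metis
  from unitary_completion[OF v(1,2)] obtain U1
    where U1: "unitary_mat n U1" "\<And>i. i < n \<Longrightarrow> U1 $$ (i, 0) = v $ i" by metis
  note U1c = unitary_carrier[OF U1(1)]
  define A1 where "A1 = mat_adjoint U1 * (A * U1)"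
  have A1: "A1 \<in> carrier_mat n n" using A U1c by (auto simp: A1_def)
  have A1herm: "mat_adjoint A1 = A1"
    using A U1c herm by (auto simp: A1_def adjoint_mult mult_assoc_dim)
  have AU0: "(A * U1) $$ (l, 0) = e * U1 $$ (l, 0)" if "l < n" for l
  proof -
    have "(A * U1) $$ (l, 0) = (A *\<^sub>v v) $ l"
      using A U1c v(1) that n
      by (subst mult_index, simp, simp, simp, subst mult_vec_index) (auto simp: U1(2) intro!: sum.cong)
    thus ?thesis using v that by (simp add: U1(2))
  qed
  have col0: "A1 $$ (i, 0) = (if i = 0 then e else 0)" if "i < n" for i
  proof -
    have "A1 $$ (i, 0) = (\<Sum>l<n. cnj (U1 $$ (l, i)) * (A * U1) $$ (l, 0))"
      unfolding A1_def using A U1c that n by (subst mult_index) auto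
    also have "\<dots> = e * (\<Sum>l<n. cnj (U1 $$ (l, i)) * U1 $$ (l, 0))"
      by (simp add: AU0 sum_distrib_left mult_ac del: index_mult_mat(1))
    also have "\<dots> = (if i = 0 then e else 0)"
      using that n by (subst unitary_columns[OF U1(1)]) auto
    finally show ?thesis .
  qed
  have row0: "A1 $$ (0, i) = 0" if "i < n" "i \<noteq> 0" for i
  proof -
    have "A1 $$ (0, i) = cnj (A1 $$ (i, 0))"
      using A1 that n by (subst A1herm[symmetric], subst adjoint_index) auto
    thus ?thesis using col0[of i] that by simp
  qed
  define A3 where "A3 = mat n' n' (\<lambda>(i, j). A1 $$ (Suc i, Suc j))"
  have A3: "A3 \<in> carrier_mat n' n'" by (simp add: A3_def)
  let ?e = "mat 1 1 (\<lambda>_. e) :: complex mat"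
  have A1block: "A1 = four_block_mat ?e (0\<^sub>m 1 n') (0\<^sub>m n' 1) A3"
  proof (rule eq_matI)
    fix i j assume "i < dim_row (four_block_mat ?e (0\<^sub>m 1 n') (0\<^sub>m n' 1) A3)"
      "j < dim_col (four_block_mat ?e (0\<^sub>m 1 n') (0\<^sub>m n' 1) A3)"
    hence "i < n" "j < n" using A3 n by auto
    thus "A1 $$ (i, j) = four_block_mat ?e (0\<^sub>m 1 n') (0\<^sub>m n' 1) A3 $$ (i, j)"
      using A3 n col0 row0 by (cases i; cases j) (auto simp: A3_def)
  qed (use A1 A3 n in auto)
  have A3herm: "mat_adjoint A3 = A3"
  proof (rule eq_matI)
    fix i j assume "i < dim_row A3" "j < dim_col A3"
    hence ij: "i < n'" "j < n'" using A3 by auto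
    have "A1 $$ (Suc i, Suc j) = cnj (A1 $$ (Suc j, Suc i))"
      using ij A1 n by (subst A1herm[symmetric], subst adjoint_index) auto
    thus "mat_adjoint A3 $$ (i, j) = A3 $$ (i, j)" using ij A3 by (simp add: A3_def)
  qed (use A3 in auto)
  have AA1: "A = U1 * A1 * mat_adjoint U1"
    using A U1c by (simp add: A1_def mult_assoc_dim unitary_cancel[OF U1(1)] unitary_right[OF U1(1)])
  have "similar_mat_wit A1 A (mat_adjoint U1) U1"
  proof (rule similar_mat_witI[OF unitary_left[OF U1(1)] unitary_right[OF U1(1)]])
    show "A1 = mat_adjoint U1 * A * U1" using A U1c by (simp add: A1_def mult_assoc_dim)
  qed (use A A1 U1c in simp_all)
  hence "similar_mat A1 A" unfolding similar_mat_def by blast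
  from char_poly_similar[OF this] have "char_poly A1 = char_poly A" .
  moreover have "char_poly A1 = char_poly ?e * char_poly A3"
    unfolding A1block by (rule char_poly_four_block_zeros_col[of _ _ n']) (use A3 in auto)
  moreover have "char_poly ?e = [:- e, 1:]"
    by (simp add: char_poly_defs det_def sign_def)
  ultimately have "char_poly A3 = (\<Prod>e\<leftarrow>es. [:- e, 1:])"
    unfolding cp by (metis mult_cancel_left pCons_eq_0_iff zero_neq_one)
  from Cons.IH[OF A3 A3herm this] obtain U3
    where U3: "unitary_mat n' U3" "A3 = U3 * mat_diag n' (\<lambda>i. es ! i) * mat_adjoint U3" by blast
  note U3c = unitary_carrier[OF U3(1)]
  define U where "U = U1 * block_diag (1\<^sub>m 1) U3"
  have bd: "unitary_mat n (block_diag (1\<^sub>m 1) U3)"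
    using unitary_block_diag[OF unitary_one[of 1] U3(1)] by (simp add: n)
  have U: "unitary_mat n U" unfolding U_def by (rule unitary_mult[OF U1(1) bd])
  have D: "mat_diag n (\<lambda>i. (e # es) ! i) = block_diag ?e (mat_diag n' (\<lambda>i. es ! i))"
    by (rule eq_matI) (auto simp: n mat_diag_def nth_Cons split: nat.splits)
  have "A1 = block_diag (1\<^sub>m 1) U3 * mat_diag n (\<lambda>i. (e # es) ! i) * mat_adjoint (block_diag (1\<^sub>m 1) U3)"
  proof -
    have "block_diag (1\<^sub>m 1) U3 * mat_diag n (\<lambda>i. (e # es) ! i) = block_diag ?e (U3 * mat_diag n' (\<lambda>i. es ! i))"
      unfolding D by (subst block_diag_mult[of _ 1 1 _ 1 _ n' n' _ n']) (use U3c in auto)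
    also have "\<dots> * mat_adjoint (block_diag (1\<^sub>m 1) U3) = block_diag ?e A3"
      unfolding adjoint_block_diag U3(2)
      by (subst block_diag_mult[of _ 1 1 _ 1 _ n' n' _ n'])
         (use U3c in \<open>auto intro!: mult_carrier_mat[of _ n' n' _ n']\<close>)
    also have "\<dots> = A1" unfolding A1block using A3 by simp
    finally show ?thesis by simp
  qed
  hence "A = U * mat_diag n (\<lambda>i. (e # es) ! i) * mat_adjoint U"
    unfolding AA1 U_def using U1c U3c n
    by (auto simp: adjoint_mult mult_assoc_dim mat_diag_def)
  with U show ?case by blast
qed

theorem hermitian_spectral:
  assumes A: "A \<in> carrier_mat n n" and herm: "mat_adjoint A = A"
  obtains U e where "unitary_mat n U" "A = U * rdiag n n e * mat_adjoint U"
    "\<And>i j. i \<le> j \<Longrightarrow> j < n \<Longrightarrow> e j \<le> e i"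
proof -
  from char_poly_factorized[OF A] obtain as
    where as: "char_poly A = (\<Prod>a\<leftarrow>as. [:- a, 1:])" "length as = n" by blast
  \<comment> \<open>The eigenvalues turn out to be real, so sorting by real part sorts them.\<close>
  define es where "es = sort_key (\<lambda>z. - Re z) as"
  have "char_poly A = (\<Prod>e\<leftarrow>es. [:- e, 1:])"
    unfolding as(1) es_def by (metis (no_types) mset_map mset_sort prod_mset_prod_list)
  from hermitian_diagonalization[OF A herm this] obtain U
    where U: "unitary_mat n U" "A = U * mat_diag n (\<lambda>i. es ! i) * mat_adjoint U" by blast
  note Uc = unitary_carrier[OF U(1)]
  have D: "mat_diag n (\<lambda>i. es ! i) = mat_adjoint U * (A * U)"
    unfolding U(2) using Uc
    by (simp add: mult_assoc_dim unitary_cancel[OF U(1)] unitary_left[OF U(1)] mat_diag_def)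
  have "mat_adjoint (mat_diag n (\<lambda>i. es ! i)) = mat_diag n (\<lambda>i. es ! i)"
    unfolding D using A Uc by (simp add: adjoint_mult mult_assoc_dim herm)
  hence real: "cnj (es ! i) = es ! i" if "i < n" for i
    using that adjoint_index[of i "mat_diag n (\<lambda>i. es ! i)" i] by (simp add: mat_diag_def)
  have "mat_diag n (\<lambda>i. es ! i) = rdiag n n (\<lambda>i. Re (es ! i))"
    by (rule eq_matI) (auto simp: mat_diag_def complex_eq_iff dest!: real)
  moreover have "Re (es ! j) \<le> Re (es ! i)" if "i \<le> j" "j < n" for i j
  proof -
    have "sorted (map (\<lambda>z. - Re z) es)" by (simp add: es_def)
    from sorted_nth_mono[OF this that(1)] that as(2) show ?thesis by (simp add: es_def)
  qed
  ultimately show ?thesis using U by (intro that[of U "\<lambda>i. Re (es ! i)"]) auto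
qed


text \<open>
  Rotating the first column of \<open>C\<close> onto the first coordinate axis clears the rest of the first
  row, because the other columns are orthogonal to it.
\<close>

lemma orthogonal_columns_factor:
  assumes "C \<in> carrier_mat m n" "mat_adjoint C * C = rdiag n n (\<lambda>i. (s i)\<^sup>2)"
    and "\<And>i j. i \<le> j \<Longrightarrow> j < n \<Longrightarrow> s j \<le> s i" "\<And>i. i < n \<Longrightarrow> 0 \<le> s i"
  shows "\<exists>V. unitary_mat m V \<and> C = V * rdiag m n s"
  using assms
proof (induction n arbitrary: m C s)
  case 0
  thus ?case by (intro exI[of _ "1\<^sub>m m"]) (auto intro!: eq_matI)
next
  case (Suc n m C s)
  note C = Suc.prems(1) and CC = Suc.prems(2)
  have inner: "(\<Sum>l<m. cnj (C $$ (l, i)) * C $$ (l, j)) = (if i = j then complex_of_real ((s i)\<^sup>2) else 0)"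
    if "i < Suc n" "j < Suc n" for i j
    using gram_index[OF C that] that unfolding CC by simp
  note colnorm = gram_diag[OF C CC]
  show ?case
  proof (cases "s 0 = 0")
    case True
    have "s i = 0" if "i < Suc n" for i
      using Suc.prems(3)[of 0 i] Suc.prems(4)[of i] that True by simp
    moreover have "C $$ (l, i) = 0" if "l < m" "i < Suc n" for l i
    proof -
      have "(\<Sum>l<m. (cmod (C $$ (l, i)))\<^sup>2) = 0" using colnorm calculation that by simp
      thus ?thesis using that by (subst (asm) sum_nonneg_eq_0_iff) auto
    qed
    ultimately have "C = 1\<^sub>m m * rdiag m (Suc n) s"
      using C by (intro eq_matI) auto
    thus ?thesis using unitary_one by blast
  next
    case False
    hence s0: "s 0 > 0" using Suc.prems(4)[of 0] by simp
    have m: "m \<noteq> 0" using colnorm[of 0] s0 by (intro notI) simp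
    then obtain m' where m': "m = Suc m'" by (cases m) auto
    define v where "v = vec m (\<lambda>i. C $$ (i, 0) / complex_of_real (s 0))"
    have v: "v \<in> carrier_vec m" by (simp add: v_def)
    have "(\<Sum>i<m. (cmod (v $ i))\<^sup>2) = (\<Sum>l<m. (cmod (C $$ (l, 0)))\<^sup>2) / (s 0)\<^sup>2"
      by (simp add: v_def norm_divide power_divide sum_divide_distrib)
    hence "vnorm v = 1" using s0 v colnorm[of 0] by (simp add: vnorm_eq)
    from unitary_completion[OF v this] obtain V1
      where V1: "unitary_mat m V1" "\<And>i. i < m \<Longrightarrow> V1 $$ (i, 0) = v $ i" by metis
    note V1c = unitary_carrier[OF V1(1)]
    define C1 where "C1 = mat_adjoint V1 * C"
    have C1: "C1 \<in> carrier_mat m (Suc n)" using C V1c by (auto simp: C1_def)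
    have C1C: "C = V1 * C1" using C by (simp add: C1_def unitary_cancel[OF V1(1)])
    have C0: "C $$ (l, 0) = complex_of_real (s 0) * V1 $$ (l, 0)" if "l < m" for l
      using that s0 by (simp add: V1(2) v_def)
    have col0: "C1 $$ (i, 0) = (if i = 0 then complex_of_real (s 0) else 0)" if "i < m" for i
    proof -
      have "C1 $$ (i, 0) = (\<Sum>l<m. cnj (V1 $$ (l, i)) * C $$ (l, 0))"
        unfolding C1_def using C V1c that by (subst mult_index) auto
      also have "\<dots> = complex_of_real (s 0) * (\<Sum>l<m. cnj (V1 $$ (l, i)) * V1 $$ (l, 0))"
        by (simp add: C0 sum_distrib_left mult_ac)
      also have "\<dots> = (if i = 0 then complex_of_real (s 0) else 0)"
        using that m by (subst unitary_columns[OF V1(1)]) auto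
      finally show ?thesis .
    qed
    have row0: "C1 $$ (0, j) = 0" if "j < Suc n" "j \<noteq> 0" for j
    proof -
      have "complex_of_real (s 0) * C1 $$ (0, j) = (\<Sum>l<m. cnj (C $$ (l, 0)) * C $$ (l, j))"
        unfolding C1_def using C V1c that m
        by (subst mult_index) (auto simp: C0 sum_distrib_left mult_ac)
      also have "\<dots> = 0" using inner[of 0 j] that by simp
      finally show ?thesis using s0 by simp
    qed
    define C' where "C' = mat m' n (\<lambda>(i, j). C1 $$ (Suc i, Suc j))"
    have C': "C' \<in> carrier_mat m' n" by (simp add: C'_def)
    have C1C1: "mat_adjoint C1 * C1 = mat_adjoint C * C"
      unfolding C1C using C1 V1c by (simp add: adjoint_mult mult_assoc_dim unitary_cancel[OF V1(1)])
    have "mat_adjoint C' * C' = rdiag n n (\<lambda>i. (s (Suc i))\<^sup>2)"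
    proof (rule eq_matI)
      fix i j assume "i < dim_row (rdiag n n (\<lambda>i. (s (Suc i))\<^sup>2))" "j < dim_col (rdiag n n (\<lambda>i. (s (Suc i))\<^sup>2))"
      hence ij: "i < n" "j < n" by auto
      have "(mat_adjoint C1 * C1) $$ (Suc i, Suc j) = (\<Sum>l<m. cnj (C1 $$ (l, Suc i)) * C1 $$ (l, Suc j))"
        using ij by (intro gram_index[OF C1]) auto
      also have "\<dots> = (\<Sum>l<m'. cnj (C' $$ (l, i)) * C' $$ (l, j))"
        using ij row0[of "Suc i"] unfolding m' sum.lessThan_Suc_shift by (simp add: C'_def)
      also have "\<dots> = (mat_adjoint C' * C') $$ (i, j)"
        using ij by (intro gram_index[OF C', symmetric]) auto
      finally show "(mat_adjoint C' * C') $$ (i, j) = rdiag n n (\<lambda>i. (s (Suc i))\<^sup>2) $$ (i, j)"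
        using ij unfolding C1C1 CC by simp
    qed (use C' in auto)
    from Suc.IH[OF C' this] Suc.prems(3,4) obtain V'
      where V': "unitary_mat m' V'" "C' = V' * rdiag m' n (\<lambda>i. s (Suc i))" by auto
    note V'c = unitary_carrier[OF V'(1)]
    let ?s = "mat 1 1 (\<lambda>_. complex_of_real (s 0))"
    have bd: "unitary_mat m (block_diag (1\<^sub>m 1) V')"
      using unitary_block_diag[OF unitary_one[of 1] V'(1)] by (simp add: m')
    have D: "rdiag m (Suc n) s = block_diag ?s (rdiag m' n (\<lambda>i. s (Suc i)))"
      by (rule eq_matI) (auto simp: m' split: nat.splits)
    have "C1 = block_diag ?s C'"
    proof (rule eq_matI)
      fix i j assume "i < dim_row (block_diag ?s C')" "j < dim_col (block_diag ?s C')"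
      hence "i < m" "j < Suc n" using C' m' by auto
      thus "C1 $$ (i, j) = block_diag ?s C' $$ (i, j)"
        using C' m' col0 row0 by (cases i; cases j) (auto simp: C'_def)
    qed (use C1 C' m' in auto)
    also have "\<dots> = block_diag (1\<^sub>m 1) V' * rdiag m (Suc n) s"
      unfolding D V'(2) by (subst block_diag_mult[of _ 1 1 _ 1 _ m' m' _ n]) (use V'c in auto)
    finally have "C = (V1 * block_diag (1\<^sub>m 1) V') * rdiag m (Suc n) s"
      unfolding C1C using V1c V'c m' by (simp add: mult_assoc_dim)
    with unitary_mult[OF V1(1) bd] show ?thesis by blast
  qed
qed

text \<open>
  Continuing the singular values by zeros lets sums over rows and sums over columns share one
  sequence.
\<close>

definition singular_seq :: "nat \<Rightarrow> (nat \<Rightarrow> real) \<Rightarrow> bool" where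
  "singular_seq q s \<longleftrightarrow> antimono s \<and> (\<forall>i. 0 \<le> s i) \<and> (\<forall>i\<ge>q. s i = 0)"

lemma singular_seqD:
  assumes "singular_seq q s"
  shows "0 \<le> s i" "q \<le> i \<Longrightarrow> s i = 0" "i \<le> j \<Longrightarrow> s j \<le> s i"
  using assms by (auto simp: singular_seq_def antimono_def)

text \<open>
  If \<open>W\<close> diagonalises \<open>F\<^sup>*F\<close>, the columns of \<open>FW\<close> are orthogonal.
\<close>

theorem svd_exists:
  assumes F: "F \<in> carrier_mat m n"
  obtains V W s where "unitary_mat m V" "unitary_mat n W" "F = V * rdiag m n s * mat_adjoint W"
    "singular_seq (min m n) s"
proof -
  have "mat_adjoint (mat_adjoint F * F) = mat_adjoint F * F" "mat_adjoint F * F \<in> carrier_mat n n"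
    using F by (auto simp: adjoint_mult)
  from hermitian_spectral[OF this(2,1)] obtain W e
    where W: "unitary_mat n W" "mat_adjoint F * F = W * rdiag n n e * mat_adjoint W"
      "\<And>i j. i \<le> j \<Longrightarrow> j < n \<Longrightarrow> e j \<le> e i" by metis
  note Wc = unitary_carrier[OF W(1)]
  define C where "C = F * W"
  have C: "C \<in> carrier_mat m n" using F Wc by (auto simp: C_def)
  have "mat_adjoint C * C = mat_adjoint W * (mat_adjoint F * F) * W"
    using F Wc by (simp add: C_def adjoint_mult mult_assoc_dim)
  also have "\<dots> = rdiag n n e"
    unfolding W(2) using Wc
    by (simp add: mult_assoc_dim unitary_cancel[OF W(1)] unitary_left[OF W(1)])
  finally have CC: "mat_adjoint C * C = rdiag n n e" .
  note colnorm = gram_diag[OF C CC]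
  have e0: "e i \<ge> 0" if "i < n" for i
    using colnorm[OF that] by (metis sum_nonneg zero_le_power2)
  have "rdiag n n e = rdiag n n (\<lambda>i. (sqrt (e i))\<^sup>2)"
    by (rule eq_matI) (auto simp: e0)
  hence "mat_adjoint C * C = rdiag n n (\<lambda>i. (sqrt (e i))\<^sup>2)" using CC by simp
  from orthogonal_columns_factor[OF C this] W(3) e0 obtain V
    where V: "unitary_mat m V" "C = V * rdiag m n (\<lambda>i. sqrt (e i))" by auto
  define s where "s i = (if i < min m n then sqrt (e i) else 0)" for i
  have "rdiag m n (\<lambda>i. sqrt (e i)) = rdiag m n s"
    by (rule eq_matI) (auto simp: s_def)
  hence "F * W = V * rdiag m n s" using V(2) by (simp add: C_def)
  hence "F * W * mat_adjoint W = V * rdiag m n s * mat_adjoint W" by simp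
  moreover have "F * W * mat_adjoint W = F"
    using F Wc by (simp add: mult_assoc_dim unitary_right[OF W(1)])
  moreover have "singular_seq (min m n) s"
    using W(3) e0 by (auto simp: singular_seq_def s_def antimono_def)
  ultimately show ?thesis using V(1) W(1) by (intro that) auto
qed

section \<open>Singular values, rank and Parseval frames in terms of a decomposition\<close>

lemma adjoint_cscalar:
  fixes A :: "complex mat"
  assumes "A \<in> carrier_mat m n" "x \<in> carrier_vec n" "y \<in> carrier_vec m"
  shows "(A *\<^sub>v x) \<bullet>c y = x \<bullet>c (mat_adjoint A *\<^sub>v y)"
proof -
  have "(A *\<^sub>v x) \<bullet>c y = (\<Sum>i<m. (\<Sum>l<n. A $$ (i, l) * x $ l) * cnj (y $ i))"
    using assms by (simp add: scalar_prod_def[of _ "conjugate y"] atLeast0LessThan mult_vec_index del: index_mult_mat_vec)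
  also have "\<dots> = (\<Sum>l<n. x $ l * (\<Sum>i<m. A $$ (i, l) * cnj (y $ i)))"
    by (simp add: sum_distrib_left sum_distrib_right mult_ac) (rule sum.swap)
  also have "\<dots> = (\<Sum>l<n. x $ l * cnj (\<Sum>i<m. cnj (A $$ (i, l)) * y $ i))" by simp
  also have "\<dots> = x \<bullet>c (mat_adjoint A *\<^sub>v y)"
    using assms by (simp add: scalar_prod_def[of x] atLeast0LessThan mult_vec_index del: index_mult_mat_vec)
  finally show ?thesis .
qed

lemma unitary_vnorm:
  assumes U: "unitary_mat n U" and x: "x \<in> carrier_vec n"
  shows "vnorm (U *\<^sub>v x) = vnorm x"
proof -
  note Uc = unitary_carrier[OF U]
  have "mat_adjoint U *\<^sub>v (U *\<^sub>v x) = x"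
    using assoc_mult_mat_vec[OF adjoint_carrier[OF Uc] Uc x] x by (simp add: unitary_left[OF U])
  thus ?thesis
    using adjoint_cscalar[OF Uc x, of "U *\<^sub>v x"] Uc x by (simp add: vnorm_def)
qed

lemma char_poly_unitary_rdiag:
  assumes W: "unitary_mat n W"
  shows "char_poly (W * rdiag n n d * mat_adjoint W) =
    (\<Prod>a\<leftarrow>map (\<lambda>i. complex_of_real (d i)) [0..<n]. [:- a, 1:])"
proof -
  note Wc = unitary_carrier[OF W]
  have "similar_mat_wit (W * rdiag n n d * mat_adjoint W) (rdiag n n d) W (mat_adjoint W)"
    by (rule similar_mat_witI[OF unitary_right[OF W] unitary_left[OF W]]) (use Wc in auto)
  hence "char_poly (W * rdiag n n d * mat_adjoint W) = char_poly (rdiag n n d)"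
    by (intro char_poly_similar) (auto simp: similar_mat_def)
  also have "\<dots> = (\<Prod>a\<leftarrow>diag_mat (rdiag n n d). [:- a, 1:])"
    by (rule char_poly_upper_triangular[of _ n]) auto
  also have "diag_mat (rdiag n n d) = map (\<lambda>i. complex_of_real (d i)) [0..<n]"
    by (auto simp: diag_mat_def)
  finally show ?thesis .
qed

lemma proots_linear_factors:
  "proots (\<Prod>a\<leftarrow>as. [:- a, 1 :: complex:]) = mset as"
proof (induction as)
  case (Cons a as)
  have "(\<Prod>a\<leftarrow>as. [:- a, 1 :: complex:]) \<noteq> 0" by (auto simp: prod_list_zero_iff)
  thus ?case using Cons by (simp add: proots_mult del: mult_pCons_left)
qed simp

lemma svd_gram:
  assumes "unitary_mat m V" "unitary_mat n W" "F = V * rdiag m n s * mat_adjoint W"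
    and "singular_seq (min m n) s"
  shows "mat_adjoint F * F = W * rdiag n n (\<lambda>i. (s i)\<^sup>2) * mat_adjoint W"
proof -
  have "rdiag n m s * rdiag m n s = rdiag n n (\<lambda>i. (s i)\<^sup>2)"
    unfolding rdiag_rdiag using assms(4)
    by (intro eq_matI) (auto simp: power2_eq_square singular_seq_def)
  thus ?thesis
    using unitary_carrier[OF assms(1)] unitary_carrier[OF assms(2)] unfolding assms(3)
    by (simp add: adjoint_mult mult_assoc_dim unitary_cancel[OF assms(1)])
       (simp add: mult_assoc_dim[symmetric])
qed

lemma singular_values_svd:
  assumes "unitary_mat m V" "unitary_mat n W" "F = V * rdiag m n s * mat_adjoint W"
    and s: "singular_seq (min m n) s"
  shows "singular_values F = map s [0..<min m n]"
proof -
  let ?q = "min m n"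
  have dims: "dim_row F = m" "dim_col F = n"
    using unitary_dim[OF assms(1)] unitary_dim[OF assms(2)] by (auto simp: assms(3))
  have "proots (char_poly (mat_adjoint F * F)) = mset (map (\<lambda>i. complex_of_real ((s i)\<^sup>2)) [0..<n])"
    unfolding svd_gram[OF assms] char_poly_unitary_rdiag[OF assms(2)] proots_linear_factors ..
  hence "image_mset (\<lambda>z. sqrt (Re z)) (proots (char_poly (mat_adjoint F * F))) = mset (map s [0..<n])"
    using s by (simp add: multiset.map_comp o_def singular_seq_def flip: of_real_power)
  moreover have "sort (map s [0..<n]) = rev (map s [0..<n])"
  proof (rule properties_for_sort)
    have "sorted_wrt (\<ge>) (map s [0..<n])"
      using s by (auto simp: sorted_wrt_iff_nth_less singular_seq_def antimono_def)
    thus "sorted (rev (map s [0..<n]))" by (simp add: sorted_wrt_rev)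
  qed simp
  ultimately have "sorted_list_of_multiset
      (image_mset (\<lambda>z. sqrt (Re z)) (proots (char_poly (mat_adjoint F * F)))) = rev (map s [0..<n])"
    by (metis sorted_list_of_multiset_mset)
  thus ?thesis
    by (simp add: singular_values_def dims take_map take_upt)
qed

lemma singular_value_svd:
  assumes "unitary_mat m V" "unitary_mat n W" "F = V * rdiag m n s * mat_adjoint W"
    and "singular_seq (min m n) s" "i < min m n"
  shows "singular_value F (Suc i) = s i"
  using assms(5) by (simp add: singular_value_def singular_values_svd[OF assms(1-4)])

lemma singular_seq_unique:
  assumes "unitary_mat m V" "unitary_mat n W" "F = V * rdiag m n s * mat_adjoint W"
    and s: "singular_seq (min m n) s"
    and "unitary_mat m V'" "unitary_mat n W'" "F = V' * rdiag m n t * mat_adjoint W'"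
    and t: "singular_seq (min m n) t"
  shows "t = s"
proof
  fix i show "t i = s i"
    using singular_value_svd[OF assms(1-4), of i] singular_value_svd[OF assms(5-8), of i] s t
    by (cases "i < min m n") (auto simp: singular_seq_def)
qed

lemma span_cols_eq_range:
  assumes "A \<in> carrier_mat m n"
  shows "LinearCombinations.module.span class_ring (cspace m) (set (cols A)) =
    {A *\<^sub>v x | x. x \<in> carrier_vec n}"
proof -
  interpret vec_space "TYPE(complex)" m .
  show ?thesis using col_space_eq[OF assms] assms by (auto simp: col_space_def)
qed

text \<open>
  \<open>BC\<close> has the same range as \<open>B = (BC)D\<close>, whose \<open>r\<close> columns are orthonormal.
\<close>

lemma rank_isometric_factor:
  fixes B C D :: "complex mat"
  assumes B: "B \<in> carrier_mat m r" and BB: "mat_adjoint B * B = 1\<^sub>m r"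
    and C: "C \<in> carrier_mat r n" and D: "D \<in> carrier_mat n r" and CD: "C * D = 1\<^sub>m r"
  shows "vec_space.rank m (B * C) = r"
proof -
  interpret vec_space "TYPE(complex)" m .
  have BC: "B * C \<in> carrier_mat m n" using B C by auto
  have BCD: "B = B * C * D" using B C D CD by (simp add: mult_assoc_dim)
  have "span (set (cols (B * C))) = span (set (cols B))"
    unfolding span_cols_eq_range[OF BC] span_cols_eq_range[OF B]
  proof (intro equalityI subsetI)
    fix y assume "y \<in> {B * C *\<^sub>v x | x. x \<in> carrier_vec n}"
    then obtain x where "y = B * C *\<^sub>v x" "x \<in> carrier_vec n" by blast
    thus "y \<in> {B *\<^sub>v x | x. x \<in> carrier_vec r}"
      using B C by (auto intro!: exI[of _ "C *\<^sub>v x"])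
  next
    fix y assume "y \<in> {B *\<^sub>v x | x. x \<in> carrier_vec r}"
    then obtain x where x: "y = B *\<^sub>v x" "x \<in> carrier_vec r" by blast
    have "B *\<^sub>v x = B * C *\<^sub>v (D *\<^sub>v x)"
      using BC D x by (subst BCD) (auto intro: assoc_mult_mat_vec)
    thus "y \<in> {B * C *\<^sub>v x | x. x \<in> carrier_vec n}"
      using D x by (auto intro!: exI[of _ "D *\<^sub>v x"])
  qed
  hence "rank (B * C) = rank B" by (simp add: rank_def)
  also have "rank B = r"
  proof (rule lin_indpt_full_rank[OF B])
    show dist: "distinct (cols B)"
    proof (subst distinct_conv_nth, intro allI impI notI)
      fix i j assume ij: "i < length (cols B)" "j < length (cols B)" "i \<noteq> j" "cols B ! i = cols B ! j"
      hence "col B i = col B j" "i < r" "j < r" using B by auto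
      hence "(mat_adjoint B * B) $$ (i, i) = (mat_adjoint B * B) $$ (i, j)"
        using B by (subst (1 2) index_mult_mat) auto
      thus False using ij B by (simp add: BB del: index_mult_mat)
    qed
    show "\<not> lin_dep (set (cols B))"
    proof
      assume "lin_dep (set (cols B))"
      from lin_depE[OF B this dist] obtain v
        where v: "v \<in> carrier_vec r" "v \<noteq> 0\<^sub>v r" "B *\<^sub>v v = 0\<^sub>v m" by metis
      have "v = mat_adjoint B * B *\<^sub>v v" using v by (simp add: BB)
      also have "\<dots> = mat_adjoint B *\<^sub>v (B *\<^sub>v v)"
        using B v by (intro assoc_mult_mat_vec[of _ r m _ r]) auto
      also have "\<dots> = 0\<^sub>v r"
        using B by (intro eq_vecI) (auto simp: v(3) mult_vec_index simp del: index_mult_mat_vec)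
      finally show False using v by simp
    qed
  qed
  finally show ?thesis .
qed

text \<open>
  With \<open>r\<close> nonzero entries in \<open>\<Sigma>\<close>, the first \<open>r\<close> columns of \<open>V\<close> form an isometric factor of \<open>F\<close>
  with a right invertible cofactor.
\<close>

lemma rank_svd:
  assumes V: "unitary_mat m V" and W: "unitary_mat n W" and F: "F = V * rdiag m n s * mat_adjoint W"
    and s: "singular_seq (min m n) s"
  shows "0 < s i \<longleftrightarrow> i < vec_space.rank m F"
proof -
  note Vc = unitary_carrier[OF V] and Wc = unitary_carrier[OF W]
  have anti: "s j \<le> s i" if "i \<le> j" for i j using s that by (simp add: singular_seq_def antimono_def)
  define r where "r = (LEAST i. s i = 0)"
  have z: "s (min m n) = 0" using s by (simp add: singular_seq_def)
  have r: "s r = 0" unfolding r_def using z by (rule LeastI)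
  have "r \<le> min m n" unfolding r_def using z by (rule Least_le)
  have pos: "0 < s i \<longleftrightarrow> i < r" for i
  proof
    show "i < r" if "0 < s i" using that r anti[of r i] by (cases "i < r") auto
    show "0 < s i" if "i < r"
      using not_less_Least[of i "\<lambda>i. s i = 0"] that s by (simp add: r_def singular_seq_def less_le)
  qed
  have nz: "s i \<noteq> 0" if "i < r" for i using pos[of i] that by simp
  have s0: "s i = 0" if "\<not> i < r" for i
    using pos[of i] s that by (simp add: singular_seq_def less_le)
  let ?B = "V * rdiag m r (\<lambda>_. 1)" and ?C = "rdiag r n s * mat_adjoint W"
  let ?D = "W * rdiag n r (\<lambda>i. 1 / s i)"
  have one: "rdiag r r (\<lambda>_. 1) = 1\<^sub>m r" by (rule eq_matI) auto
  have "vec_space.rank m (?B * ?C) = r"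
  proof (rule rank_isometric_factor)
    have "mat_adjoint ?B * ?B = rdiag r m (\<lambda>_. 1) * rdiag m r (\<lambda>_. 1)"
      using Vc by (simp add: adjoint_mult mult_assoc_dim unitary_cancel[OF V])
    also have "\<dots> = 1\<^sub>m r"
      unfolding rdiag_rdiag one[symmetric] using \<open>r \<le> min m n\<close> by (intro eq_matI) auto
    finally show "mat_adjoint ?B * ?B = 1\<^sub>m r" .
    have "?C * ?D = rdiag r n s * rdiag n r (\<lambda>i. 1 / s i)"
      using Wc by (simp add: mult_assoc_dim unitary_cancel[OF W])
    also have "\<dots> = 1\<^sub>m r"
      unfolding rdiag_rdiag using \<open>r \<le> min m n\<close> nz by (intro eq_matI) auto
    finally show "?C * ?D = 1\<^sub>m r" .
  qed (use Vc Wc in auto)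
  also have "?B * ?C = V * (rdiag m r (\<lambda>_. 1) * rdiag r n s) * mat_adjoint W"
    using Vc Wc by (simp add: mult_assoc_dim)
  also have "rdiag m r (\<lambda>_. 1) * rdiag r n s = rdiag m n s"
    unfolding rdiag_rdiag by (rule eq_matI) (auto simp: s0)
  finally show ?thesis using pos F by simp
qed

abbreviation corner :: "nat \<Rightarrow> nat \<Rightarrow> nat \<Rightarrow> complex mat" where
  "corner m n k \<equiv> rdiag m n (\<lambda>i. if i < k then 1 else 0)"

lemma block_corner_one:
  assumes "k \<le> min m n"
  shows "block_corner m n k (1\<^sub>m k) = corner m n k"
  by (rule eq_matI) (use assms in \<open>auto simp: block_corner_def\<close>)

lemma block_corner_diag:
  assumes "k \<le> min m n"
  shows "block_corner m n k (mat_diag k (\<lambda>i. complex_of_real (g i))) =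
    rdiag m n (\<lambda>i. if i < k then g i else 0)"
  by (rule eq_matI) (use assms in \<open>auto simp: block_corner_def mat_diag_def\<close>)

text \<open>
  The rank and the singular values depend on \<open>F\<close> alone, so the entries of \<open>\<Sigma>\<close> can be read off from
  any one decomposition.
\<close>

lemma is_svd_iff:
  assumes "unitary_mat m V\<^sub>0" "unitary_mat n W\<^sub>0" "F = V\<^sub>0 * rdiag m n s * mat_adjoint W\<^sub>0"
    and s: "singular_seq (min m n) s"
  shows "is_svd m n F V W \<longleftrightarrow>
    unitary_mat m V \<and> unitary_mat n W \<and> F = V * rdiag m n s * mat_adjoint W"
proof -
  define r where "r = vec_space.rank m F"
  have pos: "0 < s i \<longleftrightarrow> i < r" for i unfolding r_def by (rule rank_svd[OF assms])
  have "s (min m n) = 0" using s unfolding singular_seq_def by blast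
  hence rq: "r \<le> min m n" using pos[of "min m n"] by (metis less_irrefl not_le)
  have "(if i < r then singular_value F (i + 1) else 0) = s i" for i
    using pos[of i] s rq singular_value_svd[OF assms, of i] by (auto simp: singular_seq_def less_le)
  hence "rdiag m n (\<lambda>i. if i < r then singular_value F (i + 1) else 0) = rdiag m n s"
    by simp
  with rq have "is_svd m n F V W \<longleftrightarrow>
    unitary_mat m V \<and> unitary_mat n W \<and> F = V * rdiag m n s * mat_adjoint W"
    unfolding is_svd_def Let_def r_def[symmetric] by (subst block_corner_diag) auto
  thus ?thesis .
qed

lemma column_family_eq_cols: "column_family A = cols A"
proof -
  have "A *\<^sub>v unit_vec (dim_col A) j = col A j" if "j < dim_col A" for j
    using that by (intro eq_vecI) auto
  thus ?thesis by (simp add: column_family_def cols_def)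
qed


lemma rdiag_unit_vec_vnorm:
  assumes "i < n"
  shows "(vnorm (rdiag m n s *\<^sub>v unit_vec n i))\<^sup>2 = (if i < m then (s i)\<^sup>2 else 0)"
proof -
  have "(vnorm (rdiag m n s *\<^sub>v unit_vec n i))\<^sup>2 =
    (\<Sum>l<m. (cmod (if l = i then complex_of_real (s i) else 0))\<^sup>2)"
    using assms unfolding vnorm_sq by (intro sum.cong) auto
  also have "\<dots> = (\<Sum>l<m. if l = i then (s i)\<^sup>2 else 0)"
    by (intro sum.cong) auto
  finally show ?thesis by simp
qed

lemma analysis_norm:
  assumes "set w \<subseteq> carrier_vec m" "x \<in> carrier_vec m"
  shows "(\<Sum>j<length w. (cmod (x \<bullet>c (w ! j)))\<^sup>2) = (vnorm (mat_adjoint (mat_of_cols m w) *\<^sub>v x))\<^sup>2"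
proof -
  have "(mat_adjoint (mat_of_cols m w) *\<^sub>v x) $ j = x \<bullet>c (w ! j)" if j: "j < length w" for j
  proof -
    have "w ! j \<in> carrier_vec m" using assms(1) j by auto
    thus ?thesis
      using assms(2) j
      by (subst mult_vec_index)
         (auto simp: scalar_prod_def atLeast0LessThan mat_of_cols_index mult.commute intro!: sum.cong)
  qed
  thus ?thesis by (simp add: vnorm_sq del: index_mult_mat_vec)
qed

text \<open>
  If \<open>M = V\<Sigma>W\<^sup>*\<close>, testing the Parseval identity on the image of the \<open>i\<close>-th column of \<open>W\<close>
  gives \<open>s\<^sub>i\<^sup>2 = s\<^sub>i\<^sup>4\<close>, so every singular value of a Parseval frame is \<open>0\<close> or \<open>1\<close>; the excess
  fixes how many are \<open>1\<close>.
\<close>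

lemma parseval_frames_eq:
  assumes k: "k \<le> min m n"
  shows "parseval_frames m n (n - k) =
    {cols (V * corner m n k * mat_adjoint W) | V W. unitary_mat m V \<and> unitary_mat n W}"
proof (intro equalityI subsetI)
  interpret vec_space "TYPE(complex)" m .
  fix w assume "w \<in> parseval_frames m n (n - k)"
  then obtain K where w: "length w = n" "parseval_frame_for m w K" "excess m w K = n - k"
    by (auto simp: parseval_frames_def)
  hence wc: "set w \<subseteq> carrier_vec m" and K: "span (set w) = K"
    and pars: "\<And>x. x \<in> K \<Longrightarrow> (vnorm x)\<^sup>2 = (\<Sum>j<length w. (cmod (x \<bullet>c (w ! j)))\<^sup>2)"
    by (auto simp: parseval_frame_for_def frame_for_def)
  define M where "M = mat_of_cols m w"
  have M: "M \<in> carrier_mat m n" and colsM: "cols M = w"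
    using w(1) wc by (auto simp: M_def)
  from svd_exists[OF M] obtain V W s where V: "unitary_mat m V" and W: "unitary_mat n W"
    and MVW: "M = V * rdiag m n s * mat_adjoint W" and s: "singular_seq (min m n) s" by metis
  note Vc = unitary_carrier[OF V] and Wc = unitary_carrier[OF W]
  have K_eq: "K = {M *\<^sub>v x | x. x \<in> carrier_vec n}"
    using span_cols_eq_range[OF M] by (simp add: colsM K)
  \<comment> \<open>The Parseval identity at the image of the \<open>i\<close>-th right singular vector.\<close>
  have s4: "(s i)\<^sup>2 = (s i)\<^sup>2 * (s i)\<^sup>2" if i: "i < min m n" for i
  proof -
    let ?e = "unit_vec n i :: complex vec"
    define x where "x = M *\<^sub>v (W *\<^sub>v ?e)"
    have x: "x \<in> carrier_vec m" using M Wc by (auto simp: x_def)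
    have ce: "rdiag m n s *\<^sub>v ?e \<in> carrier_vec m" by (intro mult_mat_vec_carrier[of _ m n]) auto
    have "M * W = V * rdiag m n s"
      using Vc Wc by (simp add: MVW mult_assoc_dim unitary_left[OF W])
    hence x_eq: "x = V *\<^sub>v (rdiag m n s *\<^sub>v ?e)"
      using M Wc Vc unfolding x_def
      by (subst assoc_mult_mat_vec[symmetric, of _ m n _ n]) (auto intro!: assoc_mult_mat_vec)
    have "mat_adjoint M * V = W * rdiag n m s"
      using Vc Wc by (simp add: MVW adjoint_mult mult_assoc_dim unitary_left[OF V])
    hence "mat_adjoint M *\<^sub>v x = W *\<^sub>v (rdiag n m s *\<^sub>v (rdiag m n s *\<^sub>v ?e))"
      using M Wc Vc ce unfolding x_eq
      by (subst assoc_mult_mat_vec[symmetric, of _ n m _ m]) (auto intro!: assoc_mult_mat_vec)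
    also have "rdiag n m s *\<^sub>v (rdiag m n s *\<^sub>v ?e) = (rdiag n m s * rdiag m n s) *\<^sub>v ?e"
      by (rule assoc_mult_mat_vec[symmetric, of _ n m _ n]) auto
    finally have Mx: "mat_adjoint M *\<^sub>v x = W *\<^sub>v (rdiag n m s * rdiag m n s *\<^sub>v ?e)" .
    have "(vnorm (mat_adjoint M *\<^sub>v x))\<^sup>2 = (vnorm (rdiag n m s * rdiag m n s *\<^sub>v ?e))\<^sup>2"
      unfolding Mx by (subst unitary_vnorm[OF W]) (auto intro!: mult_mat_vec_carrier[of _ n n])
    also have "\<dots> = (s i * s i)\<^sup>2"
      unfolding rdiag_rdiag using i by (subst rdiag_unit_vec_vnorm) auto
    finally have "(vnorm (mat_adjoint M *\<^sub>v x))\<^sup>2 = (s i * s i)\<^sup>2" .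
    moreover have "(vnorm x)\<^sup>2 = (s i)\<^sup>2"
      using i ce unfolding x_eq by (subst unitary_vnorm[OF V]) (auto simp: rdiag_unit_vec_vnorm)
    moreover have "x \<in> K" unfolding K_eq x_def using Wc by auto
    ultimately show ?thesis
      using pars[of x] analysis_norm[OF wc x] by (simp add: M_def power_mult_distrib power2_eq_square mult_ac)
  qed
  have s01: "s i = 0 \<or> s i = 1" for i
  proof (cases "i < min m n")
    case True
    have "s i \<ge> 0" using s by (simp add: singular_seq_def)
    thus ?thesis using s4[OF True] unfolding mult_cancel_left1 power2_eq_1_iff by auto
  next
    case False
    hence "min m n \<le> i" by linarith
    thus ?thesis using singular_seqD(2)[OF s] by blast
  qed
  have "rank M \<le> n" by (rule rank_le_nc[OF M])
  moreover have "n - rank M = n - k"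
    using w(1,3) by (simp add: excess_def rank_def colsM K)
  ultimately have rk: "rank M = k" using k by linarith
  have "s i = (if i < k then 1 else 0)" for i
    using rank_svd[OF V W MVW s, of i] s01[of i] by (auto simp: rk)
  hence "s = (\<lambda>i. if i < k then 1 else 0)" by (rule ext)
  hence "w = cols (V * corner m n k * mat_adjoint W)" using MVW colsM by simp
  with V W show "w \<in> {cols (V * corner m n k * mat_adjoint W) | V W. unitary_mat m V \<and> unitary_mat n W}"
    by blast
next
  interpret vec_space "TYPE(complex)" m .
  fix w assume "w \<in> {cols (V * corner m n k * mat_adjoint W) | V W. unitary_mat m V \<and> unitary_mat n W}"
  then obtain V W where V: "unitary_mat m V" and W: "unitary_mat n W"
    and w: "w = cols (V * corner m n k * mat_adjoint W)" by blast
  note Vc = unitary_carrier[OF V] and Wc = unitary_carrier[OF W]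
  define M where "M = V * corner m n k * mat_adjoint W"
  have M: "M \<in> carrier_mat m n" using Vc Wc by (auto simp: M_def)
  have wM: "w = cols M" by (simp add: w M_def)
  have Mw: "mat_of_cols m w = M" using mat_of_cols_cols[of M] M by (simp add: wM)
  have len: "length w = n" using M by (simp add: wM)
  have wc: "set w \<subseteq> carrier_vec m" using cols_dim[of M] M by (simp add: wM)
  define K where "K = span (set w)"
  have K_eq: "K = {M *\<^sub>v x | x. x \<in> carrier_vec n}"
    using span_cols_eq_range[OF M] by (simp add: wM K_def)
  have "rdiag m n s * (rdiag n m s * rdiag m n s) = corner m n k" if "s = (\<lambda>i. if i < k then 1 else 0)" for s
    unfolding rdiag_rdiag using k by (intro eq_matI) (auto simp: that)
  hence MMM: "M * (mat_adjoint M * M) = M"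
    using Vc Wc
    by (simp add: M_def adjoint_mult mult_assoc_dim unitary_cancel[OF V] unitary_cancel[OF W])
       (simp add: mult_assoc_dim[symmetric])
  have pars: "(vnorm x)\<^sup>2 = (\<Sum>j<length w. (cmod (x \<bullet>c (w ! j)))\<^sup>2)" if "x \<in> K" for x
  proof -
    from that obtain y where y: "y \<in> carrier_vec n" "x = M *\<^sub>v y" by (auto simp: K_eq)
    have x: "x \<in> carrier_vec m" using M y by auto
    have Mx: "M *\<^sub>v (mat_adjoint M *\<^sub>v x) = x"
    proof -
      have "M *\<^sub>v (mat_adjoint M *\<^sub>v x) = M * (mat_adjoint M * M) *\<^sub>v y"
        using M y
        by (simp add: assoc_mult_mat_vec[of _ m n _ n] assoc_mult_mat_vec[of _ n m _ n] mult_carrier_mat[of _ n m])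
      thus ?thesis by (simp add: MMM y)
    qed
    have "x \<bullet>c x = (M *\<^sub>v (mat_adjoint M *\<^sub>v x)) \<bullet>c x" by (simp add: Mx)
    also have "\<dots> = (mat_adjoint M *\<^sub>v x) \<bullet>c (mat_adjoint M *\<^sub>v x)"
      by (rule adjoint_cscalar[OF M mult_mat_vec_carrier[OF adjoint_carrier[OF M] x] x])
    finally have "vnorm (mat_adjoint M *\<^sub>v x) = vnorm x" by (simp add: vnorm_def)
    thus ?thesis using analysis_norm[OF wc x] by (simp add: Mw)
  qed
  have "singular_seq (min m n) (\<lambda>i. if i < k then 1 else 0)"
    using k by (auto simp: singular_seq_def antimono_def)
  note rk = rank_svd[OF V W M_def this]
  have "\<not> rank M < k" "\<not> k < rank M" using rk[of "rank M"] rk[of k] by (auto split: if_splits)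
  hence "rank M = k" by simp
  hence "excess m w K = n - k" using M by (simp add: excess_def K_def rank_def wM)
  moreover have "parseval_frame_for m w K"
    using wc pars span_is_subspace[of "set w"] by (auto simp: parseval_frame_for_def frame_for_def K_def)
  ultimately show "w \<in> parseval_frames m n (n - k)"
    using len by (auto simp: parseval_frames_def)
qed

section \<open>The distance to a partial isometry\<close>

definition frob2 :: "complex mat \<Rightarrow> real" where
  "frob2 A = (\<Sum>j<dim_col A. \<Sum>i<dim_row A. (cmod (A $$ (i, j)))\<^sup>2)"

lemma frob2_adjoint: "frob2 (mat_adjoint A) = frob2 A"
  unfolding frob2_def by (subst sum.swap) simp

lemma frob2_gram:
  assumes "C \<in> carrier_mat m n"
  shows "complex_of_real (frob2 C) = (\<Sum>j<n. (mat_adjoint C * C) $$ (j, j))"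
  using assms by (simp add: frob2_def gram_index cnj_mult_self del: index_mult_mat(1))

lemma frob2_unitary_left:
  assumes U: "unitary_mat m U" and A: "A \<in> carrier_mat m n"
  shows "frob2 (U * A) = frob2 A"
proof -
  note Uc = unitary_carrier[OF U]
  have "mat_adjoint (U * A) * (U * A) = mat_adjoint A * A"
    using A Uc by (simp add: adjoint_mult mult_assoc_dim unitary_cancel[OF U])
  hence "complex_of_real (frob2 (U * A)) = complex_of_real (frob2 A)"
    using frob2_gram[OF A] frob2_gram[of "U * A" m n] A Uc by auto
  thus ?thesis by simp
qed

lemma frob2_unitary_right:
  assumes U: "unitary_mat n U" and A: "A \<in> carrier_mat m n"
  shows "frob2 (A * mat_adjoint U) = frob2 A"
proof -
  have "frob2 (A * mat_adjoint U) = frob2 (mat_adjoint (A * mat_adjoint U))"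
    by (rule frob2_adjoint[symmetric])
  also have "mat_adjoint (A * mat_adjoint U) = U * mat_adjoint A"
    using A unitary_carrier[OF U] by (simp add: adjoint_mult)
  also have "frob2 \<dots> = frob2 A"
    using frob2_unitary_left[OF U, of "mat_adjoint A" m] A by (simp add: frob2_adjoint)
  finally show ?thesis .
qed

lemma frob2_rdiag:
  "frob2 (rdiag m n s) = (\<Sum>i<min m n. (s i)\<^sup>2)"
proof -
  have "frob2 (rdiag m n s) = (\<Sum>j<n. \<Sum>i<m. if i = j then (s j)\<^sup>2 else 0)"
    unfolding frob2_def by (intro sum.cong) auto
  also have "\<dots> = (\<Sum>j<n. if j < m then (s j)\<^sup>2 else 0)"
    by (simp add: sum.delta)
  also have "\<dots> = (\<Sum>j\<in>{..<n} \<inter> {..<m}. (s j)\<^sup>2)"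
    by (simp add: sum.inter_restrict)
  also have "{..<n} \<inter> {..<m} = {..<min m n}" by auto
  finally show ?thesis .
qed

lemma frob2_family:
  assumes "length f = n" "length u = n" "set f \<subseteq> carrier_vec m" "set u \<subseteq> carrier_vec m"
  shows "(\<Sum>j<length f. (vnorm (f ! j - u ! j))\<^sup>2) = frob2 (mat_of_cols m f - mat_of_cols m u)"
  unfolding frob2_def
proof (intro sum.cong)
  fix j assume j: "j \<in> {..<dim_col (mat_of_cols m f - mat_of_cols m u)}"
  hence "f ! j \<in> carrier_vec m" "u ! j \<in> carrier_vec m" using assms by auto
  thus "(vnorm (f ! j - u ! j))\<^sup>2 =
    (\<Sum>i<dim_row (mat_of_cols m f - mat_of_cols m u). (cmod ((mat_of_cols m f - mat_of_cols m u) $$ (i, j)))\<^sup>2)"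
    using j assms by (simp add: vnorm_sq mat_of_cols_index)
qed (use assms in auto)

text \<open>
  The gain is the real part of the trace of \<open>Y\<^sup>*\<Sigma>\<close>: up to the factor \<open>-2\<close>, the
  cross term in the squared Frobenius distance between \<open>\<Sigma>\<close> and \<open>Y\<close>.
\<close>

definition gain :: "(nat \<Rightarrow> real) \<Rightarrow> complex mat \<Rightarrow> real" where
  "gain s Y = (\<Sum>i<min (dim_row Y) (dim_col Y). s i * Re (Y $$ (i, i)))"

lemma cmod_diff_sq: "(cmod (z - w))\<^sup>2 = (cmod z)\<^sup>2 + (cmod w)\<^sup>2 - 2 * Re (z * cnj w)"
  by (simp add: cmod_power2) (simp add: power2_eq_square algebra_simps)

lemma frob2_rdiag_diff:
  assumes Y: "Y \<in> carrier_mat m n"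
  shows "frob2 (rdiag m n s - Y) = frob2 (rdiag m n s) + frob2 Y - 2 * gain s Y"
proof -
  have "(\<Sum>j<n. \<Sum>i<m. Re (rdiag m n s $$ (i, j) * cnj (Y $$ (i, j)))) =
    (\<Sum>j<n. \<Sum>i<m. if i = j then s j * Re (Y $$ (j, j)) else 0)"
    by (intro sum.cong) auto
  also have "\<dots> = (\<Sum>j<n. if j < m then s j * Re (Y $$ (j, j)) else 0)"
    by (simp add: sum.delta)
  also have "\<dots> = (\<Sum>j\<in>{..<n} \<inter> {..<m}. s j * Re (Y $$ (j, j)))"
    by (simp add: sum.inter_restrict)
  also have "{..<n} \<inter> {..<m} = {..<min m n}" by auto
  finally have g: "(\<Sum>j<n. \<Sum>i<m. Re (rdiag m n s $$ (i, j) * cnj (Y $$ (i, j)))) = gain s Y"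
    using Y by (simp add: gain_def)
  have "frob2 (rdiag m n s - Y) = (\<Sum>j<n. \<Sum>i<m. (cmod (rdiag m n s $$ (i, j)))\<^sup>2 +
      (cmod (Y $$ (i, j)))\<^sup>2 - 2 * Re (rdiag m n s $$ (i, j) * cnj (Y $$ (i, j))))"
    unfolding frob2_def using Y by (intro sum.cong) (auto simp: cmod_diff_sq simp del: rdiag_index)
  also have "\<dots> = (\<Sum>j<n. \<Sum>i<m. (cmod (rdiag m n s $$ (i, j)))\<^sup>2) +
      (\<Sum>j<n. \<Sum>i<m. (cmod (Y $$ (i, j)))\<^sup>2) - 2 * gain s Y"
    by (simp only: sum.distrib sum_subtractf sum_distrib_left g[symmetric])
  finally show ?thesis
    using Y by (simp add: frob2_def)
qed

text \<open>
  Unitary factors preserve the Frobenius norm, so the distance is measured in the coordinates of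
  the singular value decomposition; there \<open>AE\<^sub>kB\<^sup>*\<close> has squared norm \<open>k\<close>.
\<close>

lemma distance_to_partial_isometry:
  assumes V0: "unitary_mat m V\<^sub>0" and W0: "unitary_mat n W\<^sub>0"
    and F: "F = V\<^sub>0 * rdiag m n s * mat_adjoint W\<^sub>0"
    and A: "unitary_mat m A" and B: "unitary_mat n B" and k: "k \<le> min m n"
    and X: "X = V\<^sub>0 * (A * corner m n k * mat_adjoint B) * mat_adjoint W\<^sub>0"
  shows "frob2 (F - X) = (\<Sum>i<min m n. (s i)\<^sup>2) + k - 2 * gain s (A * corner m n k * mat_adjoint B)"
proof -
  let ?Y = "A * corner m n k * mat_adjoint B"
  note c = unitary_carrier[OF V0] unitary_carrier[OF W0] unitary_carrier[OF A] unitary_carrier[OF B]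
  have AE: "A * corner m n k \<in> carrier_mat m n" using c by auto
  have Y: "?Y \<in> carrier_mat m n" using c by auto
  have D: "rdiag m n s - ?Y \<in> carrier_mat m n" by (rule minus_carrier_mat[OF Y])
  have "F - X = V\<^sub>0 * (rdiag m n s - ?Y) * mat_adjoint W\<^sub>0"
    unfolding F X using c Y
    by (subst mult_minus_distrib_mat[of _ m m _ n]) (auto intro!: minus_mult_distrib_mat[symmetric])
  hence "frob2 (F - X) = frob2 (rdiag m n s - ?Y)"
    using frob2_unitary_right[OF W0, of "V\<^sub>0 * (rdiag m n s - ?Y)" m] frob2_unitary_left[OF V0 D] c(1) D
    by auto
  also have "\<dots> = frob2 (rdiag m n s) + frob2 ?Y - 2 * gain s ?Y"
    by (rule frob2_rdiag_diff[OF Y])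
  also have "frob2 ?Y = k"
    unfolding frob2_unitary_right[OF B AE] frob2_unitary_left[OF A rdiag_carrier]
  proof -
    have "frob2 (corner m n k) = (\<Sum>i<min m n. if i < k then 1 else 0)"
      unfolding frob2_rdiag by (intro sum.cong) auto
    also have "\<dots> = (\<Sum>i\<in>{..<min m n} \<inter> {..<k}. 1)" by (subst sum.inter_restrict) auto
    also have "{..<min m n} \<inter> {..<k} = {..<k}" using k by auto
    finally show "frob2 (corner m n k) = k" by simp
  qed
  finally show ?thesis by (simp add: frob2_rdiag)
qed

section \<open>Maximising the gain\<close>

lemma corner_sandwich_index:
  assumes A: "A \<in> carrier_mat m m" and B: "B \<in> carrier_mat n n" and k: "k \<le> min m n"
    and ij: "i < m" "j < n"
  shows "(A * corner m n k * mat_adjoint B) $$ (i, j) = (\<Sum>l<k. A $$ (i, l) * cnj (B $$ (j, l)))"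
proof -
  have "(A * corner m n k * mat_adjoint B) $$ (i, j) = (A * (corner m n k * mat_adjoint B)) $$ (i, j)"
    using A B by (simp add: mult_assoc_dim)
  also have "\<dots> = (\<Sum>l<m. A $$ (i, l) * (corner m n k * mat_adjoint B) $$ (l, j))"
    using A B ij by (subst mult_index) auto
  also have "\<dots> = (\<Sum>l<m. if l < k then A $$ (i, l) * cnj (B $$ (j, l)) else 0)"
    using A B ij k by (intro sum.cong) (auto simp: rdiag_mult_index[of _ n n] simp del: index_mult_mat(1))
  also have "\<dots> = (\<Sum>l\<in>{..<m} \<inter> {..<k}. A $$ (i, l) * cnj (B $$ (j, l)))"
    by (simp add: sum.inter_restrict)
  also have "{..<m} \<inter> {..<k} = {..<k}" using k by auto
  finally show ?thesis .
qed

definition threshold :: "nat \<Rightarrow> (nat \<Rightarrow> real) \<Rightarrow> real \<Rightarrow> bool" where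
  "threshold k s \<tau> \<longleftrightarrow> (\<forall>i<k. \<tau> \<le> s i) \<and> (\<forall>i\<ge>k. s i \<le> \<tau>)"

text \<open>
  Off the level \<open>s\<^sub>i = \<tau>\<close>, the weight \<open>a\<close> is the indicator of \<open>{..<k}\<close>.
\<close>

definition saturated :: "nat \<Rightarrow> nat \<Rightarrow> (nat \<Rightarrow> real) \<Rightarrow> real \<Rightarrow> (nat \<Rightarrow> real) \<Rightarrow> bool" where
  "saturated k N s \<tau> a \<longleftrightarrow>
    (\<forall>i<k. (s i - \<tau>) * (1 - a i) = 0) \<and> (\<forall>i. k \<le> i \<longrightarrow> i < N \<longrightarrow> (\<tau> - s i) * a i = 0)"

text \<open>
  Since \<open>a\<close> and the indicator of \<open>{..<k}\<close> have the same total mass, \<open>s\<close> may be replaced by \<open>s - \<tau>\<close>.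
  Then \<open>a\<close> loses for the mass it misses before position \<open>k\<close> and for the mass it places after.
\<close>

lemma weighted_sum_deficit:
  fixes a s :: "nat \<Rightarrow> real"
  assumes "k \<le> N" and mass: "(\<Sum>i<N. a i) = k"
  shows "(\<Sum>i<k. s i) - (\<Sum>i<N. s i * a i) =
    (\<Sum>i<k. (s i - \<tau>) * (1 - a i)) + (\<Sum>i=k..<N. (\<tau> - s i) * a i)"
proof -
  have split: "(\<Sum>i<N. g i) = (\<Sum>i<k. g i) + (\<Sum>i=k..<N. g i)" for g :: "nat \<Rightarrow> real"
    using sum.atLeastLessThan_concat[of 0 k N g] assms(1) by (simp add: atLeast0LessThan)
  have "\<tau> * (\<Sum>i<k. a i) + \<tau> * (\<Sum>i=k..<N. a i) = \<tau> * k"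
    using mass unfolding split by (simp add: distrib_left flip: distrib_left)
  thus ?thesis
    unfolding split[of "\<lambda>i. s i * a i"]
    by (simp add: algebra_simps sum.distrib sum_subtractf flip: sum_distrib_left sum_distrib_right)
qed


lemma weighted_sum_bound:
  fixes a s :: "nat \<Rightarrow> real"
  assumes "k \<le> N" "(\<Sum>i<N. a i) = k" and a: "\<forall>i<N. 0 \<le> a i \<and> a i \<le> 1"
    and \<tau>: "threshold k s \<tau>"
  shows "(\<Sum>i<N. s i * a i) \<le> (\<Sum>i<k. s i)"
    and "(\<Sum>i<N. s i * a i) = (\<Sum>i<k. s i) \<Longrightarrow> saturated k N s \<tau> a"
proof -
  have 1: "0 \<le> (s i - \<tau>) * (1 - a i)" if "i < k" for i
    using that assms by (simp add: threshold_def)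
  have 2: "0 \<le> (\<tau> - s i) * a i" if "k \<le> i" "i < N" for i
    using that assms by (simp add: threshold_def)
  have s1: "0 \<le> (\<Sum>i<k. (s i - \<tau>) * (1 - a i))" by (rule sum_nonneg) (use 1 in auto)
  have s2: "0 \<le> (\<Sum>i=k..<N. (\<tau> - s i) * a i)" by (rule sum_nonneg) (use 2 in auto)
  note d = weighted_sum_deficit[OF assms(1,2), of s \<tau>]
  show "(\<Sum>i<N. s i * a i) \<le> (\<Sum>i<k. s i)" using d s1 s2 by linarith
  assume "(\<Sum>i<N. s i * a i) = (\<Sum>i<k. s i)"
  hence z: "(\<Sum>i<k. (s i - \<tau>) * (1 - a i)) = 0" "(\<Sum>i=k..<N. (\<tau> - s i) * a i) = 0"
    using d s1 s2 by linarith+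
  have "(s i - \<tau>) * (1 - a i) = 0" if "i < k" for i
    using z(1) 1 that by (subst (asm) sum_nonneg_eq_0_iff) auto
  moreover have "(\<tau> - s i) * a i = 0" if "k \<le> i" "i < N" for i
    using z(2) 2 that by (subst (asm) sum_nonneg_eq_0_iff) auto
  ultimately show "saturated k N s \<tau> a" by (auto simp: saturated_def)
qed

definition row_mass :: "nat \<Rightarrow> complex mat \<Rightarrow> nat \<Rightarrow> real" where
  "row_mass k A i = (\<Sum>l<k. (cmod (A $$ (i, l)))\<^sup>2)"

lemma row_mass_nonneg: "0 \<le> row_mass k A i"
  by (simp add: row_mass_def sum_nonneg)

lemma row_mass_compl:
  assumes "unitary_mat m A" "k \<le> m" "i < m"
  shows "1 - row_mass k A i = (\<Sum>l=k..<m. (cmod (A $$ (i, l)))\<^sup>2)"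
proof -
  have "(\<Sum>l<m. (cmod (A $$ (i, l)))\<^sup>2) = row_mass k A i + (\<Sum>l=k..<m. (cmod (A $$ (i, l)))\<^sup>2)"
    using sum.atLeastLessThan_concat[of 0 k m "\<lambda>l. (cmod (A $$ (i, l)))\<^sup>2"] assms(2)
    by (simp add: atLeast0LessThan row_mass_def)
  thus ?thesis using unitary_row_norm[OF assms(1,3)] by simp
qed

lemma row_mass_le_1:
  assumes "unitary_mat m A" "k \<le> m" "i < m"
  shows "row_mass k A i \<le> 1"
proof -
  have "0 \<le> (\<Sum>l=k..<m. (cmod (A $$ (i, l)))\<^sup>2)" by (simp add: sum_nonneg)
  thus ?thesis using row_mass_compl[OF assms] by linarith
qed

lemma row_mass_sum:
  assumes "unitary_mat m A" "k \<le> m"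
  shows "(\<Sum>i<m. row_mass k A i) = k"
proof -
  have "(\<Sum>i<m. row_mass k A i) = (\<Sum>l<k. \<Sum>i<m. (cmod (A $$ (i, l)))\<^sup>2)"
    unfolding row_mass_def by (rule sum.swap)
  also have "\<dots> = (\<Sum>l<k. 1)"
    using assms by (intro sum.cong) (auto intro: unitary_column_norm)
  finally show ?thesis by simp
qed

lemma row_mass_zero:
  assumes "row_mass k A i = 0" "l < k"
  shows "A $$ (i, l) = 0"
  using assms unfolding row_mass_def by (subst (asm) sum_nonneg_eq_0_iff) auto

lemma row_mass_one:
  assumes "unitary_mat m A" "k \<le> m" "i < m" "row_mass k A i = 1" "k \<le> l" "l < m"
  shows "A $$ (i, l) = 0"
proof -
  have "(\<Sum>l=k..<m. (cmod (A $$ (i, l)))\<^sup>2) = 0"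
    using row_mass_compl[OF assms(1-3)] assms(4) by simp
  thus ?thesis using assms(5,6) by (subst (asm) sum_nonneg_eq_0_iff) auto
qed

lemma sum_singular_seq:
  assumes "singular_seq q s" "q \<le> N"
  shows "(\<Sum>i<N. s i * g i) = (\<Sum>i<q. s i * (g i :: real))"
  using assms by (intro sum.mono_neutral_right) (auto simp: singular_seqD(2))

text \<open>
  Since \<open>2 Re (z cnj w) = |z|\<^sup>2 + |w|\<^sup>2 - |z - w|\<^sup>2\<close>, the gain splits into a weighted sum of the row
  masses of \<open>A\<close> and of \<open>B\<close> and a penalty for the difference of their first \<open>k\<close> columns.
\<close>

lemma gain_eq:
  assumes A: "unitary_mat m A" and B: "unitary_mat n B" and k: "k \<le> min m n"
    and s: "singular_seq (min m n) s"
  shows "2 * gain s (A * corner m n k * mat_adjoint B) =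
    (\<Sum>i<m. s i * row_mass k A i) + (\<Sum>i<n. s i * row_mass k B i)
    - (\<Sum>i<min m n. s i * (\<Sum>l<k. (cmod (A $$ (i, l) - B $$ (i, l)))\<^sup>2))"
proof -
  note c = unitary_carrier[OF A] unitary_carrier[OF B]
  let ?Y = "A * corner m n k * mat_adjoint B"
  have "2 * Re (?Y $$ (i, i)) =
      row_mass k A i + row_mass k B i - (\<Sum>l<k. (cmod (A $$ (i, l) - B $$ (i, l)))\<^sup>2)"
    if i: "i < min m n" for i
  proof -
    have "2 * Re (?Y $$ (i, i)) = (\<Sum>l<k. 2 * Re (A $$ (i, l) * cnj (B $$ (i, l))))"
      using i by (subst corner_sandwich_index[OF c k]) (auto simp: sum_distrib_left)
    also have "\<dots> = (\<Sum>l<k. (cmod (A $$ (i, l)))\<^sup>2 + (cmod (B $$ (i, l)))\<^sup>2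
        - (cmod (A $$ (i, l) - B $$ (i, l)))\<^sup>2)"
      by (intro sum.cong) (auto simp: cmod_diff_sq)
    finally show ?thesis by (simp add: row_mass_def sum.distrib sum_subtractf)
  qed
  hence "2 * gain s ?Y = (\<Sum>i<min m n. s i * (row_mass k A i + row_mass k B i
      - (\<Sum>l<k. (cmod (A $$ (i, l) - B $$ (i, l)))\<^sup>2)))"
    using unitary_dim[OF A] unitary_dim[OF B] by (simp add: gain_def sum_distrib_left mult.left_commute)
  also have "\<dots> = (\<Sum>i<min m n. s i * row_mass k A i) + (\<Sum>i<min m n. s i * row_mass k B i)
      - (\<Sum>i<min m n. s i * (\<Sum>l<k. (cmod (A $$ (i, l) - B $$ (i, l)))\<^sup>2))"
    by (simp only: distrib_left right_diff_distrib sum.distrib sum_subtractf)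
  finally show ?thesis
    unfolding sum_singular_seq[OF s min.cobounded1] sum_singular_seq[OF s min.cobounded2] .
qed

lemma gain_one:
  assumes "k \<le> min m n"
  shows "gain s (corner m n k) = (\<Sum>i<k. s i)"
proof -
  have "gain s (corner m n k) = (\<Sum>i<min m n. if i < k then s i else 0)"
    unfolding gain_def by (intro sum.cong) auto
  also have "\<dots> = (\<Sum>i\<in>{..<min m n} \<inter> {..<k}. s i)" by (simp add: sum.inter_restrict)
  also have "{..<min m n} \<inter> {..<k} = {..<k}" using assms by auto
  finally show ?thesis .
qed

text \<open>
  Equality in the bound leaves no slack anywhere: neither in the two weighted sums, which gives
  saturation at every threshold, nor in the penalty term, which identifies the first \<open>k\<close> columns of
  \<open>A\<close> and \<open>B\<close> wherever \<open>s\<^sub>i \<noteq> 0\<close>.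
\<close>

lemma gain_bound:
  assumes A: "unitary_mat m A" and B: "unitary_mat n B" and k: "k \<le> min m n"
    and s: "singular_seq (min m n) s"
  shows gain_le: "gain s (A * corner m n k * mat_adjoint B) \<le> (\<Sum>i<k. s i)"
    and gain_maximal_columns: "gain s (A * corner m n k * mat_adjoint B) = (\<Sum>i<k. s i) \<Longrightarrow>
      l < k \<Longrightarrow> complex_of_real (s i) * A $$ (i, l) = complex_of_real (s i) * B $$ (i, l)"
    and gain_maximal_saturated: "gain s (A * corner m n k * mat_adjoint B) = (\<Sum>i<k. s i) \<Longrightarrow>
      threshold k s \<tau> \<Longrightarrow> saturated k m s \<tau> (row_mass k A) \<and> saturated k n s \<tau> (row_mass k B)"
proof -
  have km: "k \<le> m" and kn: "k \<le> n" using k by auto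
  have "\<forall>i<m. 0 \<le> row_mass k A i \<and> row_mass k A i \<le> 1"
    using row_mass_le_1[OF A km] by (simp add: row_mass_nonneg)
  note wA = weighted_sum_bound[OF km row_mass_sum[OF A km] this]
  have "\<forall>i<n. 0 \<le> row_mass k B i \<and> row_mass k B i \<le> 1"
    using row_mass_le_1[OF B kn] by (simp add: row_mass_nonneg)
  note wB = weighted_sum_bound[OF kn row_mass_sum[OF B kn] this]
  have thr: "threshold k s (s k)"
    by (auto simp: threshold_def intro: singular_seqD(3)[OF s])
  let ?P = "\<lambda>i. s i * (\<Sum>l<k. (cmod (A $$ (i, l) - B $$ (i, l)))\<^sup>2)"
  have P: "0 \<le> ?P i" for i
    using singular_seqD(1)[OF s] by (intro mult_nonneg_nonneg sum_nonneg) auto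
  have sP: "0 \<le> (\<Sum>i<min m n. ?P i)" by (intro sum_nonneg P)
  show "gain s (A * corner m n k * mat_adjoint B) \<le> (\<Sum>i<k. s i)"
    using gain_eq[OF A B k s] sP wA(1)[OF thr] wB(1)[OF thr] by linarith
  assume "gain s (A * corner m n k * mat_adjoint B) = (\<Sum>i<k. s i)"
  hence eqA: "(\<Sum>i<m. s i * row_mass k A i) = (\<Sum>i<k. s i)"
    and eqB: "(\<Sum>i<n. s i * row_mass k B i) = (\<Sum>i<k. s i)"
    and eqP: "(\<Sum>i<min m n. ?P i) = 0"
    using gain_eq[OF A B k s] sP wA(1)[OF thr] wB(1)[OF thr] by linarith+
  show "saturated k m s \<tau> (row_mass k A) \<and> saturated k n s \<tau> (row_mass k B)"
    if "threshold k s \<tau>"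
    using wA(2)[OF that eqA] wB(2)[OF that eqB] by blast
  show "complex_of_real (s i) * A $$ (i, l) = complex_of_real (s i) * B $$ (i, l)" if l: "l < k"
  proof (cases "s i = 0")
    case False
    hence i: "i < min m n" using singular_seqD(2)[OF s] by (meson not_le)
    have "?P i = 0" using eqP P i by (subst (asm) sum_nonneg_eq_0_iff) auto
    hence "(\<Sum>l<k. (cmod (A $$ (i, l) - B $$ (i, l)))\<^sup>2) = 0" using False by simp
    thus ?thesis using l by (subst (asm) sum_nonneg_eq_0_iff) auto
  qed simp
qed

lemma saturated_rows:
  assumes A: "unitary_mat m A" and k: "k \<le> m" and sat: "saturated k m s \<tau> (row_mass k A)"
    and i: "i < m" "s i \<noteq> \<tau>"
  shows "i < k \<Longrightarrow> k \<le> p \<Longrightarrow> p < m \<Longrightarrow> A $$ (i, p) = 0"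
    and "k \<le> i \<Longrightarrow> p < k \<Longrightarrow> A $$ (i, p) = 0"
proof -
  assume "i < k"
  hence "(s i - \<tau>) * (1 - row_mass k A i) = 0" using sat unfolding saturated_def by blast
  hence "row_mass k A i = 1" using i by simp
  thus "k \<le> p \<Longrightarrow> p < m \<Longrightarrow> A $$ (i, p) = 0" by (rule row_mass_one[OF A k i(1)])
next
  assume "k \<le> i"
  hence "(\<tau> - s i) * row_mass k A i = 0" using sat i(1) unfolding saturated_def by blast
  hence "row_mass k A i = 0" using i by simp
  thus "p < k \<Longrightarrow> A $$ (i, p) = 0" by (rule row_mass_zero)
qed

text \<open>
  Each row is supported in the first \<open>k\<close> columns or in the others, unless \<open>s\<^sub>i = \<tau>\<close>; so the
  weighted inner product of two columns on different sides is \<open>\<tau>\<close> times the unweighted one.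
\<close>

lemma saturated_columns_orthogonal:
  fixes s :: "nat \<Rightarrow> real"
  assumes A: "unitary_mat m A" and k: "k \<le> m" and sat: "saturated k m s \<tau> (row_mass k A)"
    and lp: "l < k" "k \<le> p" "p < m"
  shows "(\<Sum>i<m. complex_of_real (s i) * (cnj (A $$ (i, l)) * A $$ (i, p))) = 0"
proof -
  have "complex_of_real (s i) * (cnj (A $$ (i, l)) * A $$ (i, p)) =
      complex_of_real \<tau> * (cnj (A $$ (i, l)) * A $$ (i, p))" if i: "i < m" for i
  proof (cases "s i = \<tau>")
    case False
    have "A $$ (i, l) = 0 \<or> A $$ (i, p) = 0"
      using saturated_rows[OF A k sat i False] lp by (cases "i < k") auto
    thus ?thesis by auto
  qed simp
  hence "(\<Sum>i<m. complex_of_real (s i) * (cnj (A $$ (i, l)) * A $$ (i, p))) =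
      complex_of_real \<tau> * (\<Sum>i<m. cnj (A $$ (i, l)) * A $$ (i, p))"
    unfolding sum_distrib_left by (intro sum.cong) auto
  also have "\<dots> = 0"
    using lp by (subst unitary_columns[OF A]) auto
  finally show ?thesis .
qed

lemma rdiag_sandwich_index:
  assumes A: "A \<in> carrier_mat m m" and B: "B \<in> carrier_mat n n" and ij: "l < m" "p < n"
  shows "(mat_adjoint A * rdiag m n s * B) $$ (l, p) =
    (\<Sum>i<min m n. complex_of_real (s i) * (cnj (A $$ (i, l)) * B $$ (i, p)))"
proof -
  have "(mat_adjoint A * rdiag m n s * B) $$ (l, p) = (mat_adjoint A * (rdiag m n s * B)) $$ (l, p)"
    using A B by (simp add: mult_assoc_dim)
  also have "\<dots> = (\<Sum>i<m. cnj (A $$ (i, l)) * (rdiag m n s * B) $$ (i, p))"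
    using A B ij by (subst mult_index) auto
  also have "\<dots> = (\<Sum>i<m. if i < n then complex_of_real (s i) * (cnj (A $$ (i, l)) * B $$ (i, p)) else 0)"
    using A B ij by (intro sum.cong) (auto simp: rdiag_mult_index[of _ n n] simp del: index_mult_mat(1))
  also have "\<dots> = (\<Sum>i\<in>{..<m} \<inter> {..<n}. complex_of_real (s i) * (cnj (A $$ (i, l)) * B $$ (i, p)))"
    by (simp add: sum.inter_restrict)
  also have "{..<m} \<inter> {..<n} = {..<min m n}" by auto
  finally show ?thesis .
qed

lemma sum_singular_seq_complex:
  assumes "singular_seq q s" "q \<le> N"
  shows "(\<Sum>i<N. complex_of_real (s i) * g i) = (\<Sum>i<q. complex_of_real (s i) * g i)"
  using assms by (intro sum.mono_neutral_right) (auto simp: singular_seqD(2))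

text \<open>
  When the gain of \<open>AE\<^sub>kB\<^sup>*\<close> is maximal, the matrix \<open>A\<^sup>*\<Sigma>B\<close> is block diagonal with a Hermitian
  upper left block. Diagonalising that block by conjugation and the other one by a singular value
  decomposition does not move \<open>E\<^sub>k\<close>, and the threshold keeps the diagonal in decreasing order.
\<close>

theorem maximiser_is_svd_corner:
  assumes A: "unitary_mat m A" and B: "unitary_mat n B" and k: "k \<le> min m n" "0 < k"
    and s: "singular_seq (min m n) s"
    and max: "gain s (A * corner m n k * mat_adjoint B) = (\<Sum>i<k. s i)"
  obtains P Q where "unitary_mat m P" "unitary_mat n Q"
    "P * rdiag m n s * mat_adjoint Q = rdiag m n s"
    "P * corner m n k * mat_adjoint Q = A * corner m n k * mat_adjoint B"
proof -
  let ?q = "min m n"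
  define \<tau> where "\<tau> = s (k - 1)"
  have \<tau>: "threshold k s \<tau>"
    using k(2) by (auto simp: threshold_def \<tau>_def intro!: singular_seqD(3)[OF s])
  have \<tau>0: "0 \<le> \<tau>" by (simp add: \<tau>_def singular_seqD(1)[OF s])
  have km: "k \<le> m" and kn: "k \<le> n" using k by auto
  note Ac = unitary_carrier[OF A] and Bc = unitary_carrier[OF B]
  note gm = gain_maximal_columns[OF A B k(1) s max]
  from gain_maximal_saturated[OF A B k(1) s max \<tau>]
  have satA: "saturated k m s \<tau> (row_mass k A)" and satB: "saturated k n s \<tau> (row_mass k B)" by auto
  define G where "G = mat_adjoint A * rdiag m n s * B"
  have G: "G \<in> carrier_mat m n" using Ac Bc by (auto simp: G_def)
  \<comment> \<open>Where \<open>s\<^sub>i \<noteq> 0\<close>, the first \<open>k\<close> columns of \<open>A\<close> may be replaced by those of \<open>B\<close>, and conversely.\<close>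
  have G_left: "G $$ (l, p) = (\<Sum>i<n. complex_of_real (s i) * (cnj (B $$ (i, l)) * B $$ (i, p)))"
    if "l < k" "p < n" for l p
  proof -
    have e: "complex_of_real (s i) * (cnj (A $$ (i, l)) * z) = complex_of_real (s i) * (cnj (B $$ (i, l)) * z)" for i z
      using arg_cong[OF gm[OF that(1), of i], of cnj] by (simp add: mult.assoc[symmetric])
    have "G $$ (l, p) = (\<Sum>i<?q. complex_of_real (s i) * (cnj (A $$ (i, l)) * B $$ (i, p)))"
      unfolding G_def using that km by (intro rdiag_sandwich_index[OF Ac Bc]) auto
    also have "\<dots> = (\<Sum>i<?q. complex_of_real (s i) * (cnj (B $$ (i, l)) * B $$ (i, p)))"
      by (simp only: e)
    also have "\<dots> = (\<Sum>i<n. complex_of_real (s i) * (cnj (B $$ (i, l)) * B $$ (i, p)))"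
      by (rule sum_singular_seq_complex[OF s min.cobounded2, symmetric])
    finally show ?thesis .
  qed
  have G_right: "G $$ (l, p) = (\<Sum>i<m. complex_of_real (s i) * (cnj (A $$ (i, l)) * A $$ (i, p)))"
    if "l < m" "p < k" for l p
  proof -
    have e: "complex_of_real (s i) * (z * B $$ (i, p)) = complex_of_real (s i) * (z * A $$ (i, p))" for i z
      using gm[OF that(2), of i] by auto
    have "G $$ (l, p) = (\<Sum>i<?q. complex_of_real (s i) * (cnj (A $$ (i, l)) * B $$ (i, p)))"
      unfolding G_def using that kn by (intro rdiag_sandwich_index[OF Ac Bc]) auto
    also have "\<dots> = (\<Sum>i<?q. complex_of_real (s i) * (cnj (A $$ (i, l)) * A $$ (i, p)))"
      by (simp only: e)
    also have "\<dots> = (\<Sum>i<m. complex_of_real (s i) * (cnj (A $$ (i, l)) * A $$ (i, p)))"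
      by (rule sum_singular_seq_complex[OF s min.cobounded1, symmetric])
    finally show ?thesis .
  qed
  have G12: "G $$ (l, p) = 0" if "l < k" "k \<le> p" "p < n" for l p
    using saturated_columns_orthogonal[OF B kn satB that] that by (simp add: G_left)
  have G21: "G $$ (p, l) = 0" if "l < k" "k \<le> p" "p < m" for l p
  proof -
    have "G $$ (p, l) = cnj (\<Sum>i<m. complex_of_real (s i) * (cnj (A $$ (i, l)) * A $$ (i, p)))"
      using that by (simp add: G_right mult.commute)
    thus ?thesis using saturated_columns_orthogonal[OF A km satA that] by simp
  qed
  define H where "H = mat k k (\<lambda>(i, j). G $$ (i, j))"
  define L where "L = mat (m - k) (n - k) (\<lambda>(i, j). G $$ (i + k, j + k))"
  have H: "H \<in> carrier_mat k k" and L: "L \<in> carrier_mat (m - k) (n - k)"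
    by (simp_all add: H_def L_def)
  have GHL: "G = block_diag H L"
    by (rule eq_matI) (use G km kn in \<open>auto simp: H_def L_def G12 G21\<close>)
  have "mat_adjoint H = H"
  proof (rule eq_matI)
    fix i j assume "i < dim_row H" "j < dim_col H"
    hence "i < k" "j < k" using H by auto
    thus "mat_adjoint H $$ (i, j) = H $$ (i, j)"
      using kn H by (simp add: H_def G_left mult.commute)
  qed (use H in auto)
  from hermitian_spectral[OF H this] obtain U e where U: "unitary_mat k U"
    and HU: "H = U * rdiag k k e * mat_adjoint U" and e: "\<And>i j. i \<le> j \<Longrightarrow> j < k \<Longrightarrow> e j \<le> e i"
    by metis
  from svd_exists[OF L] obtain V2 W2 t2 where V2: "unitary_mat (m - k) V2" and W2: "unitary_mat (n - k) W2"
    and LV: "L = V2 * rdiag (m - k) (n - k) t2 * mat_adjoint W2"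
    and t2: "singular_seq (min (m - k) (n - k)) t2" by metis
  note Uc = unitary_carrier[OF U] and V2c = unitary_carrier[OF V2] and W2c = unitary_carrier[OF W2]
  define P where "P = A * block_diag U V2"
  define Q where "Q = B * block_diag U W2"
  have bdP: "unitary_mat m (block_diag U V2)" using unitary_block_diag[OF U V2] km by simp
  have bdQ: "unitary_mat n (block_diag U W2)" using unitary_block_diag[OF U W2] kn by simp
  note bdPc = unitary_carrier[OF bdP] and bdQc = unitary_carrier[OF bdQ]
  have P: "unitary_mat m P" unfolding P_def by (rule unitary_mult[OF A bdP])
  have Q: "unitary_mat n Q" unfolding Q_def by (rule unitary_mult[OF B bdQ])
  note Pc = unitary_carrier[OF P] and Qc = unitary_carrier[OF Q]
  \<comment> \<open>The candidate for the diagonal: eigenvalues of \<open>H\<close>, then singular values of \<open>L\<close>.\<close>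
  define t where "t i = (if i < k then e i else t2 (i - k))" for i
  have sandwich: "block_diag U V2 * block_diag X Y * mat_adjoint (block_diag U W2) =
      block_diag (U * X * mat_adjoint U) (V2 * Y * mat_adjoint W2)"
    if "X \<in> carrier_mat k k" "Y \<in> carrier_mat (m - k) (n - k)" for X Y
  proof -
    have "block_diag U V2 * block_diag X Y = block_diag (U * X) (V2 * Y)"
      by (rule block_diag_mult[OF Uc that(1) V2c that(2)])
    moreover have "U * X \<in> carrier_mat k k" "V2 * Y \<in> carrier_mat (m - k) (n - k)"
      using that Uc V2c by auto
    ultimately show ?thesis
      unfolding adjoint_block_diag
      using block_diag_mult[of "U * X" k k "mat_adjoint U" k "V2 * Y" "m - k" "n - k" "mat_adjoint W2" "n - k"]
        Uc W2c by simp
  qed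
  have "rdiag m n t = block_diag (rdiag k k t) (rdiag (m - k) (n - k) (\<lambda>i. t (i + k)))"
    by (rule rdiag_block[OF km kn])
  also have "rdiag k k t = rdiag k k e" by (rule eq_matI) (auto simp: t_def)
  also have "(\<lambda>i. t (i + k)) = t2" by (simp add: t_def fun_eq_iff)
  finally have rt: "rdiag m n t = block_diag (rdiag k k e) (rdiag (m - k) (n - k) t2)" .
  have "block_diag U V2 * rdiag m n t * mat_adjoint (block_diag U W2) = G"
    unfolding rt sandwich[OF rdiag_carrier rdiag_carrier] by (simp add: GHL HU LV)
  hence "P * rdiag m n t * mat_adjoint Q = A * G * mat_adjoint B"
    unfolding P_def Q_def by (simp only: two_sided_mult[OF Ac bdPc rdiag_carrier bdQc Bc])
  also have "\<dots> = rdiag m n s"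
    using Ac Bc by (simp add: G_def mult_assoc_dim unitary_cancel[OF A] unitary_right[OF B])
  finally have PtQ: "P * rdiag m n t * mat_adjoint Q = rdiag m n s" .
  have corner_block: "corner m n k = block_diag (1\<^sub>m k) (0\<^sub>m (m - k) (n - k))"
    by (rule eq_matI) (use km kn in auto)
  have "1\<^sub>m k \<in> carrier_mat k k" "0\<^sub>m (m - k) (n - k) \<in> carrier_mat (m - k) (n - k)" by auto
  hence "block_diag U V2 * corner m n k * mat_adjoint (block_diag U W2) = corner m n k"
    unfolding corner_block by (subst sandwich) (use Uc V2c W2c in \<open>auto simp: unitary_right[OF U]\<close>)
  hence PEQ: "P * corner m n k * mat_adjoint Q = A * corner m n k * mat_adjoint B"
    unfolding P_def Q_def by (simp only: two_sided_mult[OF Ac bdPc rdiag_carrier bdQc Bc])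
  \<comment> \<open>\<open>P\<close> and \<open>Q\<close> have the same gain as \<open>A\<close> and \<open>B\<close>, so they are saturated too; this places
    \<open>t\<close> above the threshold before position \<open>k\<close> and below it from there on.\<close>
  have maxPQ: "gain s (P * corner m n k * mat_adjoint Q) = (\<Sum>i<k. s i)" using max by (simp add: PEQ)
  note gm' = gain_maximal_columns[OF P Q k(1) s maxPQ]
  from gain_maximal_saturated[OF P Q k(1) s maxPQ \<tau>]
  have satP: "saturated k m s \<tau> (row_mass k P)" and satQ: "saturated k n s \<tau> (row_mass k Q)" by auto
  have "mat_adjoint P * rdiag m n s * Q = rdiag m n t"
    using Pc Qc by (simp add: PtQ[symmetric] mult_assoc_dim unitary_cancel[OF P] unitary_left[OF Q])
  hence t_eq: "complex_of_real (t j) = (\<Sum>i<?q. complex_of_real (s i) * (cnj (P $$ (i, j)) * Q $$ (i, j)))"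
    if "j < ?q" for j
    using rdiag_sandwich_index[OF Pc Qc, of j j s] that by simp
  have t_up: "\<tau> \<le> t j" if j: "j < k" for j
  proof -
    have e: "complex_of_real (s i) * (cnj (P $$ (i, j)) * Q $$ (i, j)) =
      complex_of_real (s i * (cmod (Q $$ (i, j)))\<^sup>2)" for i
      using gm'[OF j, of i] by (auto simp: cnj_mult_self)
    have "complex_of_real (t j) = complex_of_real (\<Sum>i<?q. s i * (cmod (Q $$ (i, j)))\<^sup>2)"
      using t_eq[of j] j k(1) by (simp add: e)
    hence "t j = (\<Sum>i<?q. s i * (cmod (Q $$ (i, j)))\<^sup>2)" unfolding of_real_eq_iff .
    also have "\<dots> = (\<Sum>i<n. s i * (cmod (Q $$ (i, j)))\<^sup>2)"
      by (rule sum_singular_seq[OF s min.cobounded2, symmetric])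
    also have "\<dots> \<ge> (\<Sum>i<n. \<tau> * (cmod (Q $$ (i, j)))\<^sup>2)"
    proof (rule sum_mono)
      fix i assume "i \<in> {..<n}"
      hence i: "i < n" by simp
      show "\<tau> * (cmod (Q $$ (i, j)))\<^sup>2 \<le> s i * (cmod (Q $$ (i, j)))\<^sup>2"
      proof (cases "\<tau> \<le> s i")
        case True thus ?thesis by (simp add: mult_right_mono)
      next
        case False
        hence "k \<le> i" "s i \<noteq> \<tau>" using \<tau> by (auto simp: threshold_def not_less[symmetric])
        hence "Q $$ (i, j) = 0" using saturated_rows(2)[OF Q kn satQ i] j by blast
        thus ?thesis by simp
      qed
    qed
    also have "(\<Sum>i<n. \<tau> * (cmod (Q $$ (i, j)))\<^sup>2) = \<tau>"
      using unitary_column_norm[OF Q, of j] j kn by (simp flip: sum_distrib_left)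
    finally show ?thesis .
  qed
  have t_low: "t j \<le> \<tau>" if j: "k \<le> j" "j < ?q" for j
  proof -
    have half: "(\<Sum>i<?q. s i * (cmod (R $$ (i, j)))\<^sup>2) \<le> \<tau>"
      if R: "unitary_mat N R" "k \<le> N" "saturated k N s \<tau> (row_mass k R)" "?q \<le> N" for R N
    proof -
      have jN: "j < N" using j R(4) by linarith
      have "(\<Sum>i<?q. s i * (cmod (R $$ (i, j)))\<^sup>2) = (\<Sum>i<N. s i * (cmod (R $$ (i, j)))\<^sup>2)"
        by (rule sum_singular_seq[OF s R(4), symmetric])
      also have "\<dots> \<le> (\<Sum>i<N. \<tau> * (cmod (R $$ (i, j)))\<^sup>2)"
      proof (rule sum_mono)
        fix i assume "i \<in> {..<N}"
        hence i: "i < N" by simp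
        show "s i * (cmod (R $$ (i, j)))\<^sup>2 \<le> \<tau> * (cmod (R $$ (i, j)))\<^sup>2"
        proof (cases "s i \<le> \<tau>")
          case True thus ?thesis by (simp add: mult_right_mono)
        next
          case False
          hence "i < k" "s i \<noteq> \<tau>" using \<tau> by (auto simp: threshold_def not_le[symmetric])
          hence "R $$ (i, j) = 0" using saturated_rows(1)[OF R(1-3) i] j(1) jN by blast
          thus ?thesis by simp
        qed
      qed
      also have "\<dots> = \<tau>"
        using unitary_column_norm[OF R(1) jN] by (simp flip: sum_distrib_left)
      finally show ?thesis .
    qed
    have "2 * t j = (\<Sum>i<?q. s i * (2 * Re (Q $$ (i, j) * cnj (P $$ (i, j)))))"
      using arg_cong[OF t_eq[OF j(2)], of Re] by (simp add: sum_distrib_left algebra_simps)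
    also have "\<dots> \<le> (\<Sum>i<?q. s i * ((cmod (Q $$ (i, j)))\<^sup>2 + (cmod (P $$ (i, j)))\<^sup>2))"
    proof (intro sum_mono mult_left_mono)
      fix i show "2 * Re (Q $$ (i, j) * cnj (P $$ (i, j))) \<le> (cmod (Q $$ (i, j)))\<^sup>2 + (cmod (P $$ (i, j)))\<^sup>2"
        using cmod_diff_sq[of "Q $$ (i, j)" "P $$ (i, j)"] zero_le_power2[of "cmod (Q $$ (i, j) - P $$ (i, j))"]
        by linarith
    qed (rule singular_seqD(1)[OF s])
    also have "\<dots> = (\<Sum>i<?q. s i * (cmod (Q $$ (i, j)))\<^sup>2) + (\<Sum>i<?q. s i * (cmod (P $$ (i, j)))\<^sup>2)"
      by (simp add: distrib_left sum.distrib)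
    also have "\<dots> \<le> \<tau> + \<tau>" by (intro add_mono half[OF P km satP] half[OF Q kn satQ]) auto
    finally show ?thesis by simp
  qed
  have t_zero: "t j = 0" if "?q \<le> j" for j
  proof -
    have "min (m - k) (n - k) \<le> j - k" "\<not> j < k" using that k(1) by linarith+
    thus ?thesis using singular_seqD(2)[OF t2] by (simp add: t_def)
  qed
  have t_low': "t j \<le> \<tau>" if "k \<le> j" for j
    using t_low[OF that] t_zero[of j] \<tau>0 by (cases "j < ?q") auto
  have "singular_seq ?q t"
    unfolding singular_seq_def
  proof (intro conjI allI impI)
    show "antimono t"
    proof (rule antimonoI)
      fix i j :: nat assume ij: "i \<le> j"
      consider "j < k" | "i < k" "k \<le> j" | "k \<le> i" by linarith
      thus "t j \<le> t i"
      proof cases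
        case 1 thus ?thesis using ij e[OF ij] by (simp add: t_def)
      next
        case 2 thus ?thesis using t_up[of i] t_low'[of j] by linarith
      next
        case 3 thus ?thesis using ij singular_seqD(3)[OF t2, of "i - k" "j - k"] by (simp add: t_def)
      qed
    qed
    show "0 \<le> t i" for i
      using t_up[of i] \<tau>0 singular_seqD(1)[OF t2, of "i - k"] by (cases "i < k") (auto simp: t_def)
  qed (rule t_zero)
  moreover have "rdiag m n s = 1\<^sub>m m * rdiag m n s * mat_adjoint (1\<^sub>m n)" by simp
  ultimately have "t = s"
    using singular_seq_unique[OF unitary_one unitary_one _ s P Q PtQ[symmetric]] by metis
  with PtQ PEQ P Q show ?thesis by (intro that[of P Q]) auto
qed

text \<open>
  A threshold strictly inside the gap is met by no \<open>s\<^sub>i\<close>, so saturation determines every row.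
\<close>

lemma maximiser_unique:
  assumes A: "unitary_mat m A" and B: "unitary_mat n B" and k: "k \<le> min m n" "0 < k"
    and s: "singular_seq (min m n) s" and gap: "s k < s (k - 1)"
    and max: "gain s (A * corner m n k * mat_adjoint B) = (\<Sum>i<k. s i)"
  shows "A * corner m n k * mat_adjoint B = corner m n k"
proof (rule eq_matI)
  obtain \<tau> where \<tau>: "s k < \<tau>" "\<tau> < s (k - 1)" using dense[OF gap] by blast
  have up: "\<tau> < s i" if "i < k" for i
  proof -
    have "i \<le> k - 1" using that by linarith
    from singular_seqD(3)[OF s this] \<tau>(2) show ?thesis by (rule less_le_trans[rotated])
  qed
  have low: "s i < \<tau>" if "k \<le> i" for i
    using singular_seqD(3)[OF s that] \<tau>(1) by (rule le_less_trans)
  have "threshold k s \<tau>"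
    using up low by (auto simp: threshold_def intro: less_imp_le)
  from gain_maximal_saturated[OF A B k(1) s max this]
  have satA: "saturated k m s \<tau> (row_mass k A)" and satB: "saturated k n s \<tau> (row_mass k B)" by auto
  have ne: "s i \<noteq> \<tau>" for i using up[of i] low[of i] by (cases "i < k") auto
  have km: "k \<le> m" and kn: "k \<le> n" using k by auto
  fix i j assume "i < dim_row (corner m n k)" "j < dim_col (corner m n k)"
  hence ij: "i < m" "j < n" by auto
  have "(A * corner m n k * mat_adjoint B) $$ (i, j) = (\<Sum>l<k. A $$ (i, l) * cnj (B $$ (j, l)))"
    by (rule corner_sandwich_index[OF unitary_carrier[OF A] unitary_carrier[OF B] k(1) ij])
  also have "\<dots> = corner m n k $$ (i, j)"
  proof (cases "i < k \<and> j < k")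
    case False
    hence "A $$ (i, l) * cnj (B $$ (j, l)) = 0" if "l < k" for l
      using saturated_rows(2)[OF A km satA ij(1) ne _ that] saturated_rows(2)[OF B kn satB ij(2) ne _ that]
      by auto
    hence "(\<Sum>l<k. A $$ (i, l) * cnj (B $$ (j, l))) = 0" by (intro sum.neutral) blast
    thus ?thesis using False ij by auto
  next
    case True
    have si: "s i \<noteq> 0" using up[of i] True singular_seqD(1)[OF s, of k] low[of k] by auto
    have "(\<Sum>l<k. A $$ (i, l) * cnj (B $$ (j, l))) = (\<Sum>l<k. B $$ (i, l) * cnj (B $$ (j, l)))"
      using gain_maximal_columns[OF A B k(1) s max, of _ i] si by (intro sum.cong) auto
    also have "\<dots> = (\<Sum>l<n. B $$ (i, l) * cnj (B $$ (j, l)))"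
    proof (rule sum.mono_neutral_left)
      show "\<forall>l\<in>{..<n} - {..<k}. B $$ (i, l) * cnj (B $$ (j, l)) = 0"
        using saturated_rows(1)[OF B kn satB _ ne, of i] True kn by auto
    qed (use kn in auto)
    also have "\<dots> = (if i = j then 1 else 0)"
      using True kn by (intro unitary_rows[OF B]) auto
    finally show ?thesis using True ij by simp
  qed
  finally show "(A * corner m n k * mat_adjoint B) $$ (i, j) = corner m n k $$ (i, j)" .
qed (use unitary_dim[OF A] unitary_dim[OF B] in auto)

section \<open>Symmetric approximations\<close>

lemma two_sided_inj:
  assumes V: "unitary_mat m V" and W: "unitary_mat n W"
    and Y: "Y \<in> carrier_mat m n" "Y' \<in> carrier_mat m n"
    and eq: "cols (V * Y * mat_adjoint W) = cols (V * Y' * mat_adjoint W)"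
  shows "Y = Y'"
proof -
  note c = unitary_carrier[OF V] unitary_carrier[OF W]
  have "V * Y * mat_adjoint W = V * Y' * mat_adjoint W"
    using mat_of_cols_cols[of "V * Y * mat_adjoint W"] mat_of_cols_cols[of "V * Y' * mat_adjoint W"] c
    by (simp add: eq)
  hence "mat_adjoint V * (V * Y * mat_adjoint W) * W = mat_adjoint V * (V * Y' * mat_adjoint W) * W"
    by simp
  thus ?thesis
    using Y c by (simp add: mult_assoc_dim unitary_cancel[OF V] unitary_left[OF W])
qed

lemma change_of_coordinates:
  assumes V: "unitary_mat m V" and W: "unitary_mat n W"
    and P: "P \<in> carrier_mat m m" and Q: "Q \<in> carrier_mat n n" and X: "X \<in> carrier_mat m n"
  shows "P * X * mat_adjoint Q =
    V * ((mat_adjoint V * P) * X * mat_adjoint (mat_adjoint W * Q)) * mat_adjoint W"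
  using P Q X unitary_dim[OF V] unitary_dim[OF W]
  by (simp add: adjoint_mult mult_assoc_dim unitary_cancel[OF V] unitary_right[OF W])

text \<open>
  In the coordinates of one singular value decomposition of \<open>F\<close>, minimising the distance over
  \<open>\<J>\<^sub>n\<^sub>-\<^sub>k\<close> means maximising the gain.
\<close>

lemma symmetric_approximation_gain:
  assumes f: "length f = n" "set f \<subseteq> carrier_vec m" and k: "k \<le> min m n"
    and V: "unitary_mat m V" and W: "unitary_mat n W"
    and F: "mat_of_cols m f = V * rdiag m n s * mat_adjoint W" and s: "singular_seq (min m n) s"
  shows "symmetric_approximation (parseval_frames m n (n - k)) f u \<longleftrightarrow>
    (\<exists>A B. unitary_mat m A \<and> unitary_mat n B \<and>
      u = cols (V * (A * corner m n k * mat_adjoint B) * mat_adjoint W) \<and>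
      gain s (A * corner m n k * mat_adjoint B) = (\<Sum>i<k. s i))"
    (is "?L \<longleftrightarrow> ?R")
proof -
  let ?J = "parseval_frames m n (n - k)"
  let ?X = "\<lambda>A B. V * (A * corner m n k * mat_adjoint B) * mat_adjoint W"
  let ?c = "(\<Sum>i<min m n. (s i)\<^sup>2) + k"
  note Vc = unitary_carrier[OF V] and Wc = unitary_carrier[OF W]
  have J: "?J = {cols (?X A B) | A B. unitary_mat m A \<and> unitary_mat n B}"
  proof (intro equalityI subsetI)
    fix w assume "w \<in> ?J"
    then obtain P Q where PQ: "unitary_mat m P" "unitary_mat n Q"
      and w: "w = cols (P * corner m n k * mat_adjoint Q)"
      unfolding parseval_frames_eq[OF k] by blast
    have "w = cols (?X (mat_adjoint V * P) (mat_adjoint W * Q))"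
      unfolding w by (subst change_of_coordinates[OF V W unitary_carrier[OF PQ(1)] unitary_carrier[OF PQ(2)] rdiag_carrier]) simp
    moreover have "unitary_mat m (mat_adjoint V * P)" "unitary_mat n (mat_adjoint W * Q)"
      using PQ V W by (auto intro!: unitary_mult unitary_adjoint)
    ultimately show "w \<in> {cols (?X A B) | A B. unitary_mat m A \<and> unitary_mat n B}" by blast
  next
    fix w assume "w \<in> {cols (?X A B) | A B. unitary_mat m A \<and> unitary_mat n B}"
    then obtain A B where AB: "unitary_mat m A" "unitary_mat n B" and w: "w = cols (?X A B)" by blast
    have "?X A B = (V * A) * corner m n k * mat_adjoint (W * B)"
      using two_sided_mult[OF Vc unitary_carrier[OF AB(1)] rdiag_carrier unitary_carrier[OF AB(2)] Wc] by simp
    hence "w = cols ((V * A) * corner m n k * mat_adjoint (W * B))" using w by simp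
    with unitary_mult[OF V AB(1)] unitary_mult[OF W AB(2)] show "w \<in> ?J"
      unfolding parseval_frames_eq[OF k] by blast
  qed
  have dist: "(\<Sum>j<length f. (vnorm (f ! j - cols (?X A B) ! j))\<^sup>2) =
      ?c - 2 * gain s (A * corner m n k * mat_adjoint B)"
    if AB: "unitary_mat m A" "unitary_mat n B" for A B
  proof -
    have X: "?X A B \<in> carrier_mat m n" using Vc Wc by auto
    have "(\<Sum>j<length f. (vnorm (f ! j - cols (?X A B) ! j))\<^sup>2) =
        frob2 (mat_of_cols m f - mat_of_cols m (cols (?X A B)))"
    proof (rule frob2_family[OF f(1) _ f(2)])
      show "set (cols (?X A B)) \<subseteq> carrier_vec m"
        using cols_dim[of "?X A B"] carrier_matD(1)[OF X] by metis
    qed (use X in auto)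
    also have "mat_of_cols m (cols (?X A B)) = ?X A B"
      by (metis mat_of_cols_cols carrier_matD(1)[OF X])
    also have "frob2 (mat_of_cols m f - ?X A B) = ?c - 2 * gain s (A * corner m n k * mat_adjoint B)"
      by (rule distance_to_partial_isometry[OF V W F AB k refl])
    finally show ?thesis .
  qed
  have one: "1\<^sub>m m * corner m n k * mat_adjoint (1\<^sub>m n) = corner m n k" by simp
  show ?thesis
  proof
    assume L: ?L
    then obtain A B where AB: "unitary_mat m A" "unitary_mat n B" and u: "u = cols (?X A B)"
      unfolding symmetric_approximation_def J by blast
    have "cols (?X (1\<^sub>m m) (1\<^sub>m n)) \<in> ?J" unfolding J using unitary_one by blast
    hence "(\<Sum>j<length f. (vnorm (f ! j - u ! j))\<^sup>2) \<le>
        (\<Sum>j<length f. (vnorm (f ! j - cols (?X (1\<^sub>m m) (1\<^sub>m n)) ! j))\<^sup>2)"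
      using L unfolding symmetric_approximation_def by blast
    hence "?c - 2 * gain s (A * corner m n k * mat_adjoint B) \<le> ?c - 2 * gain s (corner m n k)"
      unfolding u dist[OF AB] dist[OF unitary_one unitary_one, unfolded one] one .
    hence "gain s (A * corner m n k * mat_adjoint B) = (\<Sum>i<k. s i)"
      using gain_le[OF AB k s] gain_one[OF k, of s] by linarith
    with AB u show ?R by blast
  next
    assume ?R
    then obtain A B where AB: "unitary_mat m A" "unitary_mat n B" and u: "u = cols (?X A B)"
      and max: "gain s (A * corner m n k * mat_adjoint B) = (\<Sum>i<k. s i)" by blast
    have "u \<in> ?J" unfolding J u using AB by blast
    moreover have "(\<Sum>j<length f. (vnorm (f ! j - u ! j))\<^sup>2) \<le> (\<Sum>j<length f. (vnorm (f ! j - x ! j))\<^sup>2)"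
      if "x \<in> ?J" for x
    proof -
      from that obtain A' B' where AB': "unitary_mat m A'" "unitary_mat n B'" and x: "x = cols (?X A' B')"
        unfolding J by blast
      show ?thesis
        unfolding u x dist[OF AB] dist[OF AB'] max using gain_le[OF AB' k s] by simp
    qed
    ultimately show ?L unfolding symmetric_approximation_def by blast
  qed
qed

lemma symmetric_approximation_svd:
  assumes f: "length f = n" "set f \<subseteq> carrier_vec m" and k: "k \<le> min m n" "0 < k"
    and V: "unitary_mat m V" and W: "unitary_mat n W"
    and F: "mat_of_cols m f = V * rdiag m n s * mat_adjoint W" and s: "singular_seq (min m n) s"
  shows "{u. symmetric_approximation (parseval_frames m n (n - k)) f u} =
    {cols (P * corner m n k * mat_adjoint Q) | P Q. is_svd m n (mat_of_cols m f) P Q}"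
proof (intro equalityI subsetI)
  note Vc = unitary_carrier[OF V] and Wc = unitary_carrier[OF W]
  fix u assume "u \<in> {u. symmetric_approximation (parseval_frames m n (n - k)) f u}"
  then obtain A B where AB: "unitary_mat m A" "unitary_mat n B"
    and u: "u = cols (V * (A * corner m n k * mat_adjoint B) * mat_adjoint W)"
    and max: "gain s (A * corner m n k * mat_adjoint B) = (\<Sum>i<k. s i)"
    using symmetric_approximation_gain[OF f k(1) V W F s] by blast
  from maximiser_is_svd_corner[OF AB k s max] obtain P Q where P: "unitary_mat m P" and Q: "unitary_mat n Q"
    and PQ: "P * rdiag m n s * mat_adjoint Q = rdiag m n s"
      "P * corner m n k * mat_adjoint Q = A * corner m n k * mat_adjoint B" by metis
  note Pc = unitary_carrier[OF P] and Qc = unitary_carrier[OF Q]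
  have "mat_of_cols m f = (V * P) * rdiag m n s * mat_adjoint (W * Q)"
    unfolding two_sided_mult[OF Vc Pc rdiag_carrier Qc Wc] PQ(1) by (rule F)
  hence "is_svd m n (mat_of_cols m f) (V * P) (W * Q)"
    unfolding is_svd_iff[OF V W F s] using unitary_mult[OF V P] unitary_mult[OF W Q] by blast
  moreover have "u = cols ((V * P) * corner m n k * mat_adjoint (W * Q))"
    unfolding two_sided_mult[OF Vc Pc rdiag_carrier Qc Wc] PQ(2) by (rule u)
  ultimately show "u \<in> {cols (P * corner m n k * mat_adjoint Q) | P Q. is_svd m n (mat_of_cols m f) P Q}"
    by blast
next
  fix u assume "u \<in> {cols (P * corner m n k * mat_adjoint Q) | P Q. is_svd m n (mat_of_cols m f) P Q}"
  then obtain P Q where PQ: "is_svd m n (mat_of_cols m f) P Q"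
    and u: "u = cols (P * corner m n k * mat_adjoint Q)" by blast
  from PQ have P: "unitary_mat m P" and Q: "unitary_mat n Q"
    and FPQ: "mat_of_cols m f = P * rdiag m n s * mat_adjoint Q"
    unfolding is_svd_iff[OF V W F s] by auto
  have one: "1\<^sub>m m * corner m n k * mat_adjoint (1\<^sub>m n) = corner m n k" by simp
  show "u \<in> {u. symmetric_approximation (parseval_frames m n (n - k)) f u}"
    unfolding mem_Collect_eq symmetric_approximation_gain[OF f k(1) P Q FPQ s]
    using unitary_one gain_one[OF k(1), of s] u by (metis one)
qed

text \<open>
  The maximiser of the gain is \<open>E\<^sub>k\<close> alone, so all singular value decompositions yield the same
  family, although their unitary factors may differ.
\<close>

lemma symmetric_approximation_gap:
  assumes f: "length f = n" "set f \<subseteq> carrier_vec m" and k: "k \<le> min m n" "0 < k"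
    and V: "unitary_mat m V" and W: "unitary_mat n W"
    and F: "mat_of_cols m f = V * rdiag m n s * mat_adjoint W" and s: "singular_seq (min m n) s"
    and gap: "s k < s (k - 1)"
  shows "{u. symmetric_approximation (parseval_frames m n (n - k)) f u} =
    {cols (V * corner m n k * mat_adjoint W)}"
proof (intro equalityI subsetI)
  fix u assume "u \<in> {u. symmetric_approximation (parseval_frames m n (n - k)) f u}"
  then obtain A B where AB: "unitary_mat m A" "unitary_mat n B"
    and u: "u = cols (V * (A * corner m n k * mat_adjoint B) * mat_adjoint W)"
    and max: "gain s (A * corner m n k * mat_adjoint B) = (\<Sum>i<k. s i)"
    using symmetric_approximation_gain[OF f k(1) V W F s] by blast
  show "u \<in> {cols (V * corner m n k * mat_adjoint W)}"
    unfolding u maximiser_unique[OF AB k s gap max] by simp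
next
  fix u assume "u \<in> {cols (V * corner m n k * mat_adjoint W)}"
  moreover have "is_svd m n (mat_of_cols m f) V W"
    unfolding is_svd_iff[OF V W F s] using V W F by blast
  ultimately show "u \<in> {u. symmetric_approximation (parseval_frames m n (n - k)) f u}"
    unfolding symmetric_approximation_svd[OF f k V W F s] by blast
qed

lemma unitary_swap:
  assumes "a < n" "b < n"
  shows "unitary_mat n (swaprows_mat n a b)"
    and "mat_adjoint (swaprows_mat n a b) = (swaprows_mat n a b :: complex mat)"
proof -
  show adj: "mat_adjoint (swaprows_mat n a b) = (swaprows_mat n a b :: complex mat)"
    by (rule eq_matI) (use assms in auto)
  show "unitary_mat n (swaprows_mat n a b)"
    using assms by (intro unitaryI) (auto simp: adj swaprows_mat_inv)
qed

lemma swap_rdiag: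
  assumes "a < min m n" "b < min m n"
  shows "swaprows_mat m a b * rdiag m n s * mat_adjoint (swaprows_mat n a b) =
    rdiag m n (s(a := s b, b := s a))"
proof -
  have "swaprows_mat m a b * rdiag m n s * mat_adjoint (swaprows_mat n a b) =
      swapcols a b (swaprows a b (rdiag m n s))"
    using assms unitary_swap(2)[of a n b]
    by (subst swapcols_mat[of _ m n]) (auto simp: swaprows_mat[of _ m n] intro!: carrier_matI)
  also have "\<dots> = rdiag m n (s(a := s b, b := s a))"
    by (rule eq_matI) (use assms in auto)
  finally show ?thesis .
qed

text \<open>
  Exchanging the singular vectors of two equal singular values gives a second minimiser.
\<close>

lemma symmetric_approximation_tie:
  assumes f: "length f = n" "set f \<subseteq> carrier_vec m" and k: "k < min m n" "0 < k"
    and V: "unitary_mat m V" and W: "unitary_mat n W"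
    and F: "mat_of_cols m f = V * rdiag m n s * mat_adjoint W" and s: "singular_seq (min m n) s"
    and tie: "s (k - 1) = s k"
  shows "\<not> (\<exists>!u. symmetric_approximation (parseval_frames m n (n - k)) f u)"
proof
  assume ex1: "\<exists>!u. symmetric_approximation (parseval_frames m n (n - k)) f u"
  note Vc = unitary_carrier[OF V] and Wc = unitary_carrier[OF W]
  have k': "k \<le> min m n" "k < m" "k < n" "k - 1 < min m n" "k - 1 < m" "k - 1 < n" using k by auto
  let ?S = "\<lambda>N. swaprows_mat N (k - 1) k :: complex mat"
  have Sm: "unitary_mat m (?S m)" and Sn: "unitary_mat n (?S n)"
    using k' by (auto intro!: unitary_swap)
  note Smc = unitary_carrier[OF Sm] and Snc = unitary_carrier[OF Sn]
  have "s(k - 1 := s k, k := s (k - 1)) = s" using tie by auto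
  hence "mat_of_cols m f = (V * ?S m) * rdiag m n s * mat_adjoint (W * ?S n)"
    unfolding two_sided_mult[OF Vc Smc rdiag_carrier Snc Wc] swap_rdiag[OF k'(4) k(1)] using F by simp
  hence "is_svd m n (mat_of_cols m f) (V * ?S m) (W * ?S n)"
    unfolding is_svd_iff[OF V W F s] using unitary_mult[OF V Sm] unitary_mult[OF W Sn] by blast
  hence "symmetric_approximation (parseval_frames m n (n - k)) f
      (cols ((V * ?S m) * corner m n k * mat_adjoint (W * ?S n)))"
    using symmetric_approximation_svd[OF f k'(1) k(2) V W F s] by blast
  moreover have "is_svd m n (mat_of_cols m f) V W"
    unfolding is_svd_iff[OF V W F s] using V W F by blast
  hence "symmetric_approximation (parseval_frames m n (n - k)) f (cols (V * corner m n k * mat_adjoint W))"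
    using symmetric_approximation_svd[OF f k'(1) k(2) V W F s] by blast
  ultimately have "cols (V * corner m n k * mat_adjoint W) =
      cols ((V * ?S m) * corner m n k * mat_adjoint (W * ?S n))"
    using ex1 by blast
  hence eq: "corner m n k = rdiag m n ((\<lambda>i. if i < k then 1 else 0)
      (k - 1 := (if k < k then 1 else 0), k := (if k - 1 < k then 1 else 0)))"
    unfolding two_sided_mult[OF Vc Smc rdiag_carrier Snc Wc]
      swap_rdiag[OF k'(4) k(1)]
    by (rule two_sided_inj[OF V W rdiag_carrier rdiag_carrier])
  show False
    using arg_cong[OF eq, of "\<lambda>M. M $$ (k - 1, k - 1)"] k k' by (simp split: if_splits)
qed

text \<open>
  Beyond the rank, the \<open>k\<close>-th left singular vector can be multiplied by any phase without
  changing \<open>F\<close>.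
\<close>

lemma symmetric_approximation_phases:
  assumes f: "length f = n" "set f \<subseteq> carrier_vec m" and k: "k \<le> min m n" "0 < k"
    and V: "unitary_mat m V" and W: "unitary_mat n W"
    and F: "mat_of_cols m f = V * rdiag m n s * mat_adjoint W" and s: "singular_seq (min m n) s"
    and zero: "s (k - 1) = 0"
  shows "infinite {u. symmetric_approximation (parseval_frames m n (n - k)) f u}"
proof -
  note Vc = unitary_carrier[OF V] and Wc = unitary_carrier[OF W]
  define \<Phi> where "\<Phi> z = mat_diag m (\<lambda>i. if i = k - 1 then z else 1)" for z :: complex
  define u where "u z = cols (V * (\<Phi> z * corner m n k) * mat_adjoint W)" for z
  have \<Phi>c: "\<Phi> z \<in> carrier_mat m m" for z by (simp add: \<Phi>_def)
  have \<Phi>: "unitary_mat m (\<Phi> z)" if "cmod z = 1" for z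
  proof (rule unitaryI[OF \<Phi>c])
    have "mat_adjoint (\<Phi> z) = \<Phi> (cnj z)"
      by (rule eq_matI) (auto simp: \<Phi>_def mat_diag_def)
    hence "mat_adjoint (\<Phi> z) * \<Phi> z = mat_diag m (\<lambda>i. 1)"
      using that by (simp add: \<Phi>_def cnj_mult_self if_distrib cong: if_cong)
    thus "mat_adjoint (\<Phi> z) * \<Phi> z = 1\<^sub>m m" by simp
  qed
  have sym: "symmetric_approximation (parseval_frames m n (n - k)) f (u z)" if z: "cmod z = 1" for z
  proof -
    have "\<Phi> z * rdiag m n s = rdiag m n s"
      unfolding \<Phi>_def by (subst mat_diag_mult_left[of _ _ n]) (use zero in \<open>auto intro!: eq_matI\<close>)
    hence "mat_of_cols m f = V * \<Phi> z * rdiag m n s * mat_adjoint W"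
      using F Vc Wc \<Phi>c[of z] by (simp add: mult_assoc_dim[of V])
    hence "is_svd m n (mat_of_cols m f) (V * \<Phi> z) W"
      unfolding is_svd_iff[OF V W F s] using unitary_mult[OF V \<Phi>[OF z]] W by blast
    moreover have "u z = cols ((V * \<Phi> z) * corner m n k * mat_adjoint W)"
      unfolding u_def using Vc \<Phi>c[of z] by (simp add: mult_assoc_dim[of V])
    ultimately show ?thesis
      using symmetric_approximation_svd[OF f k V W F s] by blast
  qed
  have inj: "z = z'" if "u z = u z'" for z z'
  proof -
    have "\<Phi> z * corner m n k = \<Phi> z' * corner m n k"
      using that unfolding u_def
      by (rule two_sided_inj[OF V W mult_carrier_mat[OF \<Phi>c rdiag_carrier] mult_carrier_mat[OF \<Phi>c rdiag_carrier]])
    hence "(\<Phi> z * corner m n k) $$ (k - 1, k - 1) = (\<Phi> z' * corner m n k) $$ (k - 1, k - 1)" by simp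
    thus ?thesis
      unfolding \<Phi>_def using k by (simp add: mat_diag_mult_left[of _ m n])
  qed
  \<comment> \<open>An arc of the unit circle, parametrised by the imaginary part.\<close>
  let ?z = "\<lambda>t. Complex (sqrt (1 - t\<^sup>2)) t"
  have "infinite ((\<lambda>t. u (?z t)) ` {0..1})"
  proof
    assume "finite ((\<lambda>t. u (?z t)) ` {0..1})"
    moreover have "inj_on (\<lambda>t. u (?z t)) {0..1}" by (intro inj_onI) (auto dest!: inj)
    ultimately have "finite {0..1 :: real}" by (rule finite_imageD)
    thus False by (simp add: infinite_Icc)
  qed
  moreover have "(\<lambda>t. u (?z t)) ` {0..1} \<subseteq> {u. symmetric_approximation (parseval_frames m n (n - k)) f u}"
    by (auto intro!: sym simp: cmod_def abs_square_le_1)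
  ultimately show ?thesis by (rule infinite_super[rotated])
qed


section \<open>The canonical polar decomposition\<close>

lemma rdiag_quadratic:
  assumes "y \<in> carrier_vec n"
  shows "(rdiag n n d *\<^sub>v y) \<bullet>c y = complex_of_real (\<Sum>i<n. d i * (cmod (y $ i))\<^sup>2)"
proof -
  have "(rdiag n n d *\<^sub>v y) $ i = complex_of_real (d i) * y $ i" if "i < n" for i
  proof -
    have "(rdiag n n d *\<^sub>v y) $ i = (\<Sum>l<n. rdiag n n d $$ (i, l) * y $ l)"
      using assms that by (subst mult_vec_index) auto
    also have "\<dots> = (\<Sum>l<n. if l = i then complex_of_real (d i) * y $ i else 0)"
      using that by (intro sum.cong) auto
    finally show ?thesis using that by simp
  qed
  hence "(rdiag n n d *\<^sub>v y) \<bullet>c y = (\<Sum>i<n. complex_of_real (d i) * y $ i * cnj (y $ i))"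
    using assms by (simp add: scalar_prod_def atLeast0LessThan del: index_mult_mat_vec)
  thus ?thesis by (simp add: mult.assoc cnj_mult_self)
qed

lemma unitary_rdiag_quadratic:
  assumes W: "unitary_mat n W" and v: "v \<in> carrier_vec n"
  shows "(W * rdiag n n d * mat_adjoint W *\<^sub>v v) \<bullet>c v =
    complex_of_real (\<Sum>i<n. d i * (cmod ((mat_adjoint W *\<^sub>v v) $ i))\<^sup>2)"
proof -
  note Wc = unitary_carrier[OF W]
  let ?y = "mat_adjoint W *\<^sub>v v"
  have y: "?y \<in> carrier_vec n" by (rule mult_mat_vec_carrier[OF adjoint_carrier[OF Wc] v])
  have Dy: "rdiag n n d *\<^sub>v ?y \<in> carrier_vec n" by (rule mult_mat_vec_carrier[OF rdiag_carrier y])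
  have "W * rdiag n n d * mat_adjoint W *\<^sub>v v = W * rdiag n n d *\<^sub>v ?y"
    by (rule assoc_mult_mat_vec[OF mult_carrier_mat[OF Wc rdiag_carrier] adjoint_carrier[OF Wc] v])
  also have "\<dots> = W *\<^sub>v (rdiag n n d *\<^sub>v ?y)"
    by (rule assoc_mult_mat_vec[OF Wc rdiag_carrier y])
  finally show ?thesis
    using adjoint_cscalar[OF Wc Dy v] rdiag_quadratic[OF y] by simp
qed

text \<open>Testing positivity on the \<open>i\<close>-th eigenvector yields the \<open>i\<close>-th eigenvalue.\<close>

lemma psd_spectral:
  assumes P: "psd_mat n P"
  obtains U d where "unitary_mat n U" "P = U * rdiag n n d * mat_adjoint U" "\<And>i. i < n \<Longrightarrow> 0 \<le> d i"
proof -
  from P have Pc: "P \<in> carrier_mat n n" and herm: "mat_adjoint P = P"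
    and nonneg: "\<And>v. v \<in> carrier_vec n \<Longrightarrow> 0 \<le> Re ((P *\<^sub>v v) \<bullet>c v)"
    by (auto simp: psd_mat_def)
  from hermitian_spectral[OF Pc herm] obtain U d
    where U: "unitary_mat n U" and PU: "P = U * rdiag n n d * mat_adjoint U" by metis
  note Uc = unitary_carrier[OF U]
  have "0 \<le> d i" if i: "i < n" for i
  proof -
    let ?e = "unit_vec n i :: complex vec"
    have e: "?e \<in> carrier_vec n" by simp
    have Ue: "U *\<^sub>v ?e \<in> carrier_vec n" by (rule mult_mat_vec_carrier[OF Uc e])
    have "mat_adjoint U *\<^sub>v (U *\<^sub>v ?e) = ?e"
      using assoc_mult_mat_vec[OF adjoint_carrier[OF Uc] Uc e] by (simp add: unitary_left[OF U])
    moreover have "(\<Sum>j<n. d j * (cmod (?e $ j))\<^sup>2) = (\<Sum>j<n. if j = i then d i else 0)"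
      using i by (intro sum.cong) auto
    ultimately have "(P *\<^sub>v (U *\<^sub>v ?e)) \<bullet>c (U *\<^sub>v ?e) = complex_of_real (d i)"
      using i unfolding PU unitary_rdiag_quadratic[OF U Ue] by simp
    thus ?thesis using nonneg[OF Ue] by simp
  qed
  with U PU show ?thesis by (rule that)
qed

text \<open>
  Between eigenbases of \<open>P\<close> and \<open>Q\<close>, the change of basis can only mix eigenvectors with equal
  \<open>d\<^sub>i\<^sup>2 = c\<^sub>j\<^sup>2\<close>, hence with \<open>d\<^sub>i = c\<^sub>j\<close>.
\<close>

lemma psd_sqrt_unique:
  assumes "psd_mat n P" "psd_mat n Q" "P * P = Q * Q"
  shows "P = Q"
proof -
  from psd_spectral[OF assms(1)] obtain Z d where Z: "unitary_mat n Z"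
    and PZ: "P = Z * rdiag n n d * mat_adjoint Z" and d: "\<And>i. i < n \<Longrightarrow> 0 \<le> d i" by metis
  from psd_spectral[OF assms(2)] obtain Y c where Y: "unitary_mat n Y"
    and QY: "Q = Y * rdiag n n c * mat_adjoint Y" and c: "\<And>i. i < n \<Longrightarrow> 0 \<le> c i" by metis
  note Zc = unitary_carrier[OF Z] and Yc = unitary_carrier[OF Y]
  define M where "M = mat_adjoint Z * Y"
  have M: "M \<in> carrier_mat n n" unfolding M_def by (rule mult_carrier_mat[OF adjoint_carrier[OF Zc] Yc])
  have "rdiag n n d * (rdiag n n d * M) = mat_adjoint Z * (P * P) * Y"
    using Zc Yc by (simp add: PZ M_def mult_assoc_dim unitary_cancel[OF Z])
  also have "\<dots> = M * (rdiag n n c * rdiag n n c)"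
    unfolding assms(3) using Zc Yc
    by (simp add: QY M_def mult_assoc_dim unitary_cancel[OF Y] unitary_left[OF Y])
  finally have sq: "rdiag n n d * (rdiag n n d * M) = M * (rdiag n n c * rdiag n n c)" .
  have "rdiag n n d * M = M * rdiag n n c"
  proof (rule eq_matI)
    fix i j assume "i < dim_row (M * rdiag n n c)" "j < dim_col (M * rdiag n n c)"
    hence ij: "i < n" "j < n" using M by auto
    have DM: "rdiag n n d * M \<in> carrier_mat n n" by (rule mult_carrier_mat[OF rdiag_carrier M])
    have "(rdiag n n d * (rdiag n n d * M)) $$ (i, j) = (M * (rdiag n n c * rdiag n n c)) $$ (i, j)"
      by (simp only: sq)
    hence "complex_of_real (d i) * (complex_of_real (d i) * M $$ (i, j)) =
        M $$ (i, j) * complex_of_real (c j * c j)"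
      unfolding rdiag_rdiag mult_rdiag_index[OF M ij] rdiag_mult_index[OF DM ij] rdiag_mult_index[OF M ij]
      using ij by simp
    hence "M $$ (i, j) * (complex_of_real (d i * d i) - complex_of_real (c j * c j)) = 0"
      by (simp add: algebra_simps)
    hence "M $$ (i, j) = 0 \<or> d i * d i = c j * c j"
      unfolding mult_eq_0_iff right_minus_eq of_real_eq_iff .
    hence "M $$ (i, j) = 0 \<or> d i = c j"
      using d[OF ij(1)] c[OF ij(2)] by (auto simp: square_eq_iff)
    thus "(rdiag n n d * M) $$ (i, j) = (M * rdiag n n c) $$ (i, j)"
      unfolding mult_rdiag_index[OF M ij] rdiag_mult_index[OF M ij] using ij by auto
  qed (use M in auto)
  hence "Z * (rdiag n n d * M) * mat_adjoint Y = Z * (M * rdiag n n c) * mat_adjoint Y" by simp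
  thus "P = Q"
    using Zc Yc
    by (simp add: PZ QY M_def mult_assoc_dim unitary_cancel[OF Z] unitary_right[OF Y])
qed

lemma mat_abs_svd:
  assumes V: "unitary_mat m V" and W: "unitary_mat n W" and F: "F = V * rdiag m n s * mat_adjoint W"
    and s: "singular_seq (min m n) s"
  shows "mat_abs F = W * rdiag n n s * mat_adjoint W"
proof -
  let ?P = "W * rdiag n n s * mat_adjoint W"
  note Vc = unitary_carrier[OF V] and Wc = unitary_carrier[OF W]
  have dim: "dim_col F = n" using Wc by (simp add: F)
  have "psd_mat n ?P"
    unfolding psd_mat_def
  proof (intro conjI ballI)
    show "?P \<in> carrier_mat n n" using Wc by auto
    show "mat_adjoint ?P = ?P" using Wc by (simp add: adjoint_mult mult_assoc_dim)
    fix v :: "complex vec" assume v: "v \<in> carrier_vec n"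
    show "0 \<le> Re ((?P *\<^sub>v v) \<bullet>c v)"
      unfolding unitary_rdiag_quadratic[OF W v] using singular_seqD(1)[OF s] by (simp add: sum_nonneg)
  qed
  moreover have "?P * ?P = mat_adjoint F * F"
  proof -
    have "rdiag n n s * rdiag n n s = rdiag n n (\<lambda>i. (s i)\<^sup>2)"
      unfolding rdiag_rdiag by (rule eq_matI) (auto simp: power2_eq_square)
    hence "W * (rdiag n n s * rdiag n n s) * mat_adjoint W = mat_adjoint F * F"
      unfolding svd_gram[OF V W F s] by simp
    thus ?thesis using Wc by (simp add: mult_assoc_dim unitary_cancel[OF W])
  qed
  ultimately show ?thesis
    unfolding mat_abs_def dim by (intro the_equality) (auto intro: psd_sqrt_unique)
qed

text \<open>
  For \<open>x\<close> orthogonal to the kernel, \<open>x - X\<^sup>*Xx\<close> lies in the kernel, hence is orthogonal to \<open>x\<close>; this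
  reads \<open>\<parallel>x\<parallel>\<^sup>2 = \<parallel>Xx\<parallel>\<^sup>2\<close>.
\<close>

lemma partial_isometryI:
  assumes X: "X \<in> carrier_mat m n" and XXX: "X * (mat_adjoint X * X) = X"
  shows "partial_isometry X"
  unfolding partial_isometry_def
proof (intro ballI impI)
  fix x assume "x \<in> carrier_vec (dim_col X)" and orth: "\<forall>y\<in>mat_kernel X. x \<bullet>c y = 0"
  hence x: "x \<in> carrier_vec n" using X by auto
  define z where "z = mat_adjoint X *\<^sub>v (X *\<^sub>v x)"
  have Xx: "X *\<^sub>v x \<in> carrier_vec m" by (rule mult_mat_vec_carrier[OF X x])
  have z: "z \<in> carrier_vec n" unfolding z_def by (rule mult_mat_vec_carrier[OF adjoint_carrier[OF X] Xx])
  have "X *\<^sub>v z = X * (mat_adjoint X * X) *\<^sub>v x"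
    using assoc_mult_mat_vec[OF adjoint_carrier[OF X] X x]
      assoc_mult_mat_vec[OF X mult_carrier_mat[OF adjoint_carrier[OF X] X] x] by (simp add: z_def)
  hence "X *\<^sub>v z = X *\<^sub>v x" by (simp add: XXX)
  hence "X *\<^sub>v (x - z) = 0\<^sub>v m"
    using mult_minus_distrib_mat_vec[OF X x z] Xx by simp
  hence "x - z \<in> mat_kernel X" using x z by (intro mat_kernelI[OF X]) auto
  hence "x \<bullet>c (x - z) = 0" using orth by blast
  moreover have "x \<bullet>c (x - z) = x \<bullet>c x - x \<bullet>c z"
    using x z by (simp add: scalar_prod_def algebra_simps sum_subtractf)
  moreover have "x \<bullet>c z = (X *\<^sub>v x) \<bullet>c (X *\<^sub>v x)"
    unfolding z_def by (rule adjoint_cscalar[OF X x Xx, symmetric])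
  ultimately show "vnorm (X *\<^sub>v x) = vnorm x" by (simp add: vnorm_def)
qed

text \<open>
  A factor \<open>U\<close> in \<open>F = U|F|\<close> is determined on the right singular vectors: the first \<open>r\<close> of them lie in
  the range of \<open>|F|\<close> and the others in the kernel of \<open>F\<close>, which is that of \<open>U\<close>.
\<close>

lemma polar_factor_svd:
  assumes V: "unitary_mat m V" and W: "unitary_mat n W" and F: "F = V * rdiag m n s * mat_adjoint W"
    and s: "singular_seq (min m n) s" and r: "\<And>i. 0 < s i \<longleftrightarrow> i < r"
  shows "polar_factor F = V * corner m n r * mat_adjoint W"
proof -
  note Vc = unitary_carrier[OF V] and Wc = unitary_carrier[OF W]
  let ?X = "V * corner m n r * mat_adjoint W"
  have Fc: "F \<in> carrier_mat m n" and X: "?X \<in> carrier_mat m n" using Vc Wc by (auto simp: F)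
  have dims: "dim_row F = m" "dim_col F = n" using Fc by auto
  have nz: "s i \<noteq> 0" if "i < r" for i using r[of i] that by simp
  have z: "s i = 0" if "\<not> i < r" for i
    using r[of i] that singular_seqD(1)[OF s, of i] by simp
  have rq: "i < min m n" if "i < r" for i
    using nz[OF that] singular_seqD(2)[OF s, of i] by linarith
  note abs = mat_abs_svd[OF V W F s]
  have XF: "F = ?X * mat_abs F"
  proof -
    have "corner m n r * rdiag n n s = rdiag m n s"
      unfolding rdiag_rdiag by (rule eq_matI) (auto simp: z)
    hence "V * (corner m n r * rdiag n n s) * mat_adjoint W = F" by (simp add: F)
    thus ?thesis using Vc Wc by (simp add: abs mult_assoc_dim unitary_cancel[OF W])
  qed
  have pi: "partial_isometry ?X"
  proof (rule partial_isometryI[OF X])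
    have "corner m n r * (rdiag n m (\<lambda>i. if i < r then 1 else 0) * corner m n r) = corner m n r"
      unfolding rdiag_rdiag by (rule eq_matI) (auto dest: rq)
    hence "V * (corner m n r * (rdiag n m (\<lambda>i. if i < r then 1 else 0) * corner m n r)) * mat_adjoint W = ?X"
      by simp
    thus "?X * (mat_adjoint ?X * ?X) = ?X"
      using Vc Wc by (simp add: adjoint_mult mult_assoc_dim unitary_cancel[OF V] unitary_cancel[OF W])
  qed
  have kerX: "mat_kernel ?X = mat_kernel F"
  proof
    \<comment> \<open>\<open>F\<close> and \<open>VE\<^sub>rW\<^sup>*\<close> are left multiples of each other; \<open>1 / s\<^sub>i\<close> is \<open>0\<close> where \<open>s\<^sub>i = 0\<close>.\<close>
    let ?N = "V * rdiag m m s * mat_adjoint V" and ?N' = "V * rdiag m m (\<lambda>i. 1 / s i) * mat_adjoint V"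
    have N: "?N \<in> carrier_mat m m" "?N' \<in> carrier_mat m m" using Vc by auto
    have "rdiag m m s * corner m n r = rdiag m n s"
      unfolding rdiag_rdiag by (rule eq_matI) (auto simp: z)
    hence "V * (rdiag m m s * corner m n r) * mat_adjoint W = F" by (simp add: F)
    hence "?N * ?X = F" using Vc Wc by (simp add: mult_assoc_dim unitary_cancel[OF V])
    thus "mat_kernel ?X \<subseteq> mat_kernel F" using mat_kernel_mult_subset[OF X N(1)] by simp
    have "rdiag m m (\<lambda>i. 1 / s i) * rdiag m n s = corner m n r"
      unfolding rdiag_rdiag by (rule eq_matI) (auto simp: nz z)
    hence "V * (rdiag m m (\<lambda>i. 1 / s i) * rdiag m n s) * mat_adjoint W = ?X" by simp
    hence "?N' * F = ?X" using Vc Wc by (simp add: F mult_assoc_dim unitary_cancel[OF V])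
    thus "mat_kernel F \<subseteq> mat_kernel ?X" using mat_kernel_mult_subset[OF Fc N(2)] by simp
  qed
  have unique: "U = ?X"
    if U: "U \<in> carrier_mat m n" "F = U * mat_abs F" "mat_kernel U = mat_kernel F" for U
  proof -
    have on_range: "(Y * W) * rdiag n n s = F * W" if "Y \<in> carrier_mat m n" "F = Y * mat_abs F" for Y
    proof -
      have "F * W = Y * mat_abs F * W" using that(2) by simp
      thus ?thesis using that(1) Wc by (simp add: abs mult_assoc_dim unitary_left[OF W])
    qed
    have UW: "U * W \<in> carrier_mat m n" by (rule mult_carrier_mat[OF U(1) Wc])
    have XW: "?X * W \<in> carrier_mat m n" by (rule mult_carrier_mat[OF X Wc])
    have "U * W = ?X * W"
    proof (rule mat_col_eqI)
      fix j assume "j < dim_col (?X * W)"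
      hence j: "j < n" using Wc by simp
      have colW: "col (Y * W) j = Y *\<^sub>v col W j" if "Y \<in> carrier_mat m n" for Y
        using that Wc j by (intro col_mult2) auto
      show "col (U * W) j = col (?X * W) j"
      proof (cases "j < r")
        case True
        have "(U * W) * rdiag n n s = (?X * W) * rdiag n n s"
          using on_range[OF U(1,2)] on_range[OF X XF] by simp
        hence entry: "(U * W) $$ (i, j) = (?X * W) $$ (i, j)" if "i < m" for i
          using mult_rdiag_index[OF UW that j, of s] mult_rdiag_index[OF XW that j, of s] nz[OF True] j by simp
        show ?thesis
        proof (rule eq_vecI)
          fix i assume "i < dim_vec (col (?X * W) j)"
          hence "i < m" using Vc by simp
          thus "col (U * W) j $ i = col (?X * W) j $ i"
            using entry index_col[of i "U * W" j] index_col[of i "?X * W" j]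
              carrier_matD[OF UW] carrier_matD[OF XW] j by metis
        qed (use U(1) Vc in simp)
      next
        case False
        have wj: "col W j \<in> carrier_vec n" using Wc j by (auto simp: col_def)
        have "F * W = V * rdiag m n s" using Vc Wc by (simp add: F mult_assoc_dim unitary_left[OF W])
        hence "F *\<^sub>v col W j = V *\<^sub>v col (rdiag m n s) j"
          using colW[OF Fc] col_mult2[OF Vc rdiag_carrier j] by simp
        also have "col (rdiag m n s) j = 0\<^sub>v m" using j by (intro eq_vecI) (auto simp: z[OF False])
        also have "V *\<^sub>v 0\<^sub>v m = 0\<^sub>v m"
          using Vc by (intro eq_vecI) (auto simp: mult_vec_index simp del: index_mult_mat_vec)
        finally have "col W j \<in> mat_kernel F" by (rule mat_kernelI[OF Fc wj])
        hence "col W j \<in> mat_kernel U" "col W j \<in> mat_kernel ?X" using U(3) kerX by auto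
        thus ?thesis
          unfolding colW[OF U(1)] colW[OF X] using mat_kernelD(2)[OF U(1)] mat_kernelD(2)[OF X] by simp
      qed
    qed (use U(1) Vc in auto)
    hence "U * W * mat_adjoint W = ?X * W * mat_adjoint W" by simp
    thus ?thesis
      using U(1) X Vc Wc by (simp add: mult_assoc_dim unitary_right[OF W] unitary_cancel[OF W])
  qed
  show ?thesis
    unfolding polar_factor_def dims
    by (rule the_equality) (use X pi XF kerX unique in blast)+
qed

section \<open>The symmetric approximations of a frame\<close>

theorem corollary4p3:
  fixes m n k r q :: nat
    and f :: "complex vec list"
    and K :: "complex vec set"
    and F :: "complex mat"
  assumes "length f = n"
    and "frame_for m f K"
    and "F = mat_of_cols m f"
    and "r = vec_space.rank m F"
    and "q = min m n"
    and "k \<in> {1..q}"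
  shows
    "{u. symmetric_approximation (parseval_frames m n (n - k)) f u} =
       {column_family (V * block_corner m n k (1\<^sub>m k) * mat_adjoint W) | V W. is_svd m n F V W}
     \<and> (k < r \<longrightarrow>
          ((\<exists>!u. symmetric_approximation (parseval_frames m n (n - k)) f u)
             \<longleftrightarrow> singular_value F k \<noteq> singular_value F (k + 1)))
     \<and> (k = r \<longrightarrow>
          {u. symmetric_approximation (parseval_frames m n (n - k)) f u}
            = {canonical_parseval_frame m f})
     \<and> (r < k \<and> k \<le> q \<longrightarrow>
          infinite {u. symmetric_approximation (parseval_frames m n (n - k)) f u})"
proof -
  let ?S = "{u. symmetric_approximation (parseval_frames m n (n - k)) f u}"
  have fm: "set f \<subseteq> carrier_vec m" using assms(2) by (simp add: frame_for_def)
  note f = assms(1) fm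
  have k: "k \<le> min m n" "0 < k" using assms(5,6) by auto
  have Fc: "F \<in> carrier_mat m n" using mat_of_cols_carrier(1)[of m f] assms(1,3) by simp
  from svd_exists[OF Fc] obtain V W s where V: "unitary_mat m V" and W: "unitary_mat n W"
    and FV: "F = V * rdiag m n s * mat_adjoint W" and s: "singular_seq (min m n) s" by metis
  have Ff: "mat_of_cols m f = V * rdiag m n s * mat_adjoint W" using FV assms(3) by simp
  have pos: "0 < s i \<longleftrightarrow> i < r" for i unfolding assms(4) by (rule rank_svd[OF V W FV s])
  have sv: "singular_value F (Suc i) = s i" if "i < min m n" for i
    by (rule singular_value_svd[OF V W FV s that])
  show ?thesis
  proof (intro conjI impI)
    show "?S = {column_family (V * block_corner m n k (1\<^sub>m k) * mat_adjoint W) | V W. is_svd m n F V W}"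
      unfolding column_family_eq_cols block_corner_one[OF k(1)] assms(3)
      by (rule symmetric_approximation_svd[OF f k V W Ff s])
  next
    assume kr: "k < r"
    have "s k \<noteq> 0" using pos[of k] kr by simp
    hence kq: "k < min m n" using singular_seqD(2)[OF s] by (meson not_le)
    have sF: "singular_value F k = s (k - 1)" "singular_value F (k + 1) = s k"
      using sv[of "k - 1"] sv[of k] kq k(2) by (auto simp: less_imp_diff_less)
    show "(\<exists>!u. symmetric_approximation (parseval_frames m n (n - k)) f u) \<longleftrightarrow>
        singular_value F k \<noteq> singular_value F (k + 1)"
    proof (cases "s (k - 1) = s k")
      case True
      thus ?thesis using symmetric_approximation_tie[OF f kq k(2) V W Ff s True] unfolding sF by blast
    next
      case False
      hence "s k < s (k - 1)" using singular_seqD(3)[OF s, of "k - 1" k] by simp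
      from symmetric_approximation_gap[OF f k V W Ff s this]
      have "symmetric_approximation (parseval_frames m n (n - k)) f u \<longleftrightarrow>
          u = cols (V * corner m n k * mat_adjoint W)" for u
        unfolding set_eq_iff mem_Collect_eq singleton_iff by (rule spec)
      hence "\<exists>!u. symmetric_approximation (parseval_frames m n (n - k)) f u" by simp
      thus ?thesis using False unfolding sF by blast
    qed
  next
    assume kr: "k = r"
    have "0 < s (k - 1)" using pos[of "k - 1"] k(2) kr by simp
    moreover have "\<not> 0 < s k" using pos[of k] kr by simp
    ultimately have "s k < s (k - 1)" by linarith
    from symmetric_approximation_gap[OF f k V W Ff s this] show "?S = {canonical_parseval_frame m f}"
      unfolding canonical_parseval_frame_def column_family_eq_cols
        polar_factor_svd[OF V W Ff s pos] kr .
  next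
    assume "r < k \<and> k \<le> q"
    hence "\<not> k - 1 < r" by linarith
    hence "s (k - 1) = 0" using pos[of "k - 1"] singular_seqD(1)[OF s, of "k - 1"] by simp
    thus "infinite ?S" by (rule symmetric_approximation_phases[OF f k V W Ff s])
  qed
qed

end
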